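(* Assume that $\tau_1=0$ and $$R\leq\min(2P-1,(I-1)^2).$$ Then the system $$\mathbf C_p=\mathbf M\mathbf D_p\mathbf M^H=\sum_{r=1}^R d_{pr}\mathbf m_r\mathbf m_r^H,\qquad p=1,\dots,P,$$ where $\mathbf M=[\mathbf m_1\ \dots\ \mathbf m_R]\in\mathbb C^{I\times R}$, $\mathbf D_1=\operatorname{diag}(d_{11},\dots,d_{1R})\in\mathbb R^{R\times R}$ and $\mathbf D_p=\operatorname{diag}(d_{p1},\dots,d_{pR})\in\mathbb C^{R\times R}$ for $p=2,\dots,P$, has a unique solution for a generic real matrix $\mathbf D_1$ and generic complex matrices $\mathbf M$ and $\mathbf D_2,\dots,\mathbf D_P$, i.e., $$\mu_n\left\{\left(d_{11},\dots,d_{1R},\operatorname{vec}\left(\tfrac{\overline{\mathbf D}+\overline{\mathbf D}^*}{2}\right),\operatorname{vec}\left(\tfrac{\overline{\mathbf D}-\overline{\mathbf D}^*}{2i}\right),\operatorname{Re}\mathbf m_1,\operatorname{Im}\mathbf m_1,\dots,\operatorname{Re}\mathbf m_R,\operatorname{Im}\mathbf m_R\right):\ \text{the solution of the system is not unique}\right\}=0,$$ where $\overline{\mathbf D}\in\mathbb C^{(P-1)\times R}$ denotes the matrix with entries $d_{pr}$ ($p>1$), $\cdot^*$ denotes the complex conjugate, $n=(2I+2P-1)R$, and $\mu_n$ is a measure that is absolutely continuous with respect to the Lebesgue measure on $\mathbb R^n$.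
   Context: The system arises in second-order blind identification. Data follow the model $\mathbf x=\mathbf M\mathbf s$, where $\mathbf x$ is the $I$-dimensional vector of observations, $\mathbf s$ is the $R$-dimensional unknown source vector and $\mathbf M$ is the $I\times R$ unknown mixing matrix; the sources are mutually uncorrelated but individually correlated in time. For lags $\tau_1,\dots,\tau_P$, $\mathbf C_p=\operatorname E(\mathbf x_t\mathbf x_{t+\tau_p}^H)$ are the spatial covariance matrices of the observations and $\mathbf D_p=\operatorname E(\mathbf s_t\mathbf s_{t+\tau_p}^H)$ is the $R\times R$ diagonal matrix with $(d_{p1},\dots,d_{pR})$ on its main diagonal. When $\tau_1=0$ the diagonal matrix $\mathbf D_1$ is real, so the system is parameterized by $R$ real and $IR+(P-1)R$ complex parameters, or equivalently by $n=R+2IR+2(P-1)R$ real parameters. The superscript $H$ denotes the Hermitian transpose. Uniqueness. If $\mathbf M$ and $\mathbf D_1,\dots,\mathbf D_P$ satisfy the system for given $\mathbf C_1,\dots,\mathbf C_P$, then the matrices $\mathbf M'=\mathbf M\mathbf\Lambda\mathbf P$ and $\mathbf D_1'=\mathbf P^T\mathbf D_1\mathbf P,\dots,\mathbf D_P'=\mathbf P^T\mathbf D_P\mathbf P$ also satisfy it for any permutation matrix $\mathbf P$ and any diagonal unitary matrix $\mathbf\Lambda$. The system is said to have a unique solution when its solution is only subject to this trivial indeterminacy.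
   Formalization: The trivial indeterminacy also includes positive scalings of the columns m_r by s_r with d_pr divided by s_r^2; with diagonal unitary Λ alone no system with M ≠ 0 has a unique solution, since (2M, D_p/4) solves it too. *)

theory Defs
  imports
    "HOL-Analysis.Analysis"
    "HOL-Combinatorics.Permutations"
    "Jordan_Normal_Form.Schur_Decomposition"
begin

section \<open>The system and its solutions\<close>

text \<open>Lags are numbered from 1 to \<open>P\<close>, rows and columns of matrices from 0.
  The lag \<open>\<tau>\<^sub>1 = 0\<close> enters only through the condition that \<open>D 1\<close> is real.\<close>

definition parameters :: "nat \<Rightarrow> nat \<Rightarrow> nat \<Rightarrow> complex mat \<Rightarrow> (nat \<Rightarrow> complex mat) \<Rightarrow> bool" where
  "parameters I R P M D \<longleftrightarrow>
     M \<in> carrier_mat I R \<and>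
     (\<forall>p\<in>{1..P}. D p \<in> carrier_mat R R \<and> diagonal_mat (D p)) \<and>
     (\<forall>r<R. D 1 $$ (r, r) \<in> \<real>)"

definition is_solution ::
  "nat \<Rightarrow> nat \<Rightarrow> nat \<Rightarrow> (nat \<Rightarrow> complex mat) \<Rightarrow> complex mat \<Rightarrow> (nat \<Rightarrow> complex mat) \<Rightarrow> bool" where
  "is_solution I R P C M D \<longleftrightarrow>
     parameters I R P M D \<and> (\<forall>p\<in>{1..P}. C p = M * D p * mat_adjoint M)"

definition permutation_matrix :: "nat \<Rightarrow> complex mat \<Rightarrow> bool" where
  "permutation_matrix R Q \<longleftrightarrow>
     (\<exists>\<pi>. \<pi> permutes {..<R} \<and> Q = mat R R (\<lambda>(i, j). if i = \<pi> j then 1 else 0))"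

definition diagonal_unitary :: "nat \<Rightarrow> complex mat \<Rightarrow> bool" where
  "diagonal_unitary R L \<longleftrightarrow>
     L \<in> carrier_mat R R \<and> diagonal_mat L \<and> L * mat_adjoint L = 1\<^sub>m R"

abbreviation real_diag :: "nat \<Rightarrow> (nat \<Rightarrow> real) \<Rightarrow> complex mat" where
  "real_diag R s \<equiv> mat_diag R (\<lambda>r. complex_of_real (s r))"

text \<open>The indeterminacy of a solution consists of a permutation \<open>Q\<close>, a diagonal unitary \<open>L\<close>
  and positive factors \<open>s r\<close>, by which a column of \<open>M\<close> is multiplied while the corresponding
  diagonal entries of the \<open>D p\<close> are divided by \<open>(s r)\<^sup>2\<close>.  The factors cannot be dispensed with:
  by lemma \<open>is_solution_rescale\<close> below they turn every solution into a solution, so without a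
  normalisation of the columns no system with \<open>M \<noteq> 0\<close> would have a unique solution.
  Between solutions with columns of norm 1 they are trivial
  (lemma \<open>trivially_related_normalized\<close>), and \<open>M' = M L Q\<close>,
  \<open>D' p = Q\<^sup>T D p Q\<close> is what remains.\<close>

definition trivially_related ::
  "nat \<Rightarrow> nat \<Rightarrow> complex mat \<Rightarrow> (nat \<Rightarrow> complex mat) \<Rightarrow> complex mat \<Rightarrow> (nat \<Rightarrow> complex mat) \<Rightarrow> bool"
  where
  "trivially_related R P M D M' D' \<longleftrightarrow>
     (\<exists>Q L s. permutation_matrix R Q \<and> diagonal_unitary R L \<and> (\<forall>r<R. 0 < s r) \<and>
        M' = M * L * real_diag R s * Q \<and>
        (\<forall>p\<in>{1..P}. D' p =
           transpose_mat Q * (real_diag R (\<lambda>r. 1 / s r) * D p * real_diag R (\<lambda>r. 1 / s r)) * Q))"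

definition unique_solution :: "nat \<Rightarrow> nat \<Rightarrow> nat \<Rightarrow> (nat \<Rightarrow> complex mat) \<Rightarrow> bool" where
  "unique_solution I R P C \<longleftrightarrow>
     (\<exists>M D. is_solution I R P C M D \<and>
        (\<forall>M' D'. is_solution I R P C M' D' \<longrightarrow> trivially_related R P M D M' D'))"

section \<open>Real coordinates\<close>

definition lebesgue_on_nat :: "nat \<Rightarrow> (nat \<Rightarrow> real) measure" where
  "lebesgue_on_nat n = completion (\<Pi>\<^sub>M k\<in>{..<n}. lborel)"

definition column_list :: "'a mat \<Rightarrow> 'a list" where
  "column_list A = concat (map list_of_vec (cols A))"

definition D_bar :: "nat \<Rightarrow> nat \<Rightarrow> (nat \<Rightarrow> complex mat) \<Rightarrow> complex mat" where
  "D_bar R P D = mat (P - 1) R (\<lambda>(i, r). D (i + 2) $$ (r, r))"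

definition coordinate_list ::
  "nat \<Rightarrow> nat \<Rightarrow> complex mat \<Rightarrow> (nat \<Rightarrow> complex mat) \<Rightarrow> real list" where
  "coordinate_list R P M D =
     map (\<lambda>r. Re (D 1 $$ (r, r))) [0..<R]
     @ column_list (map_mat Re (D_bar R P D))
     @ column_list (map_mat Im (D_bar R P D))
     @ concat (map (\<lambda>m. map Re (list_of_vec m) @ map Im (list_of_vec m)) (cols M))"

definition coordinates ::
  "nat \<Rightarrow> nat \<Rightarrow> complex mat \<Rightarrow> (nat \<Rightarrow> complex mat) \<Rightarrow> nat \<Rightarrow> real" where
  "coordinates R P M D =
     (let xs = coordinate_list R P M D in restrict (nth xs) {..<length xs})"

lemma length_concat_const:
  "(\<And>x. x \<in> set xs \<Longrightarrow> length (f x) = n) \<Longrightarrow> length (concat (map f xs)) = n * length xs"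
  by (induction xs) auto

lemma length_column_list: "length (column_list A) = dim_row A * dim_col A"
proof -
  have "length (concat (map list_of_vec (cols A))) = dim_row A * length (cols A)"
    by (rule length_concat_const) (auto simp: cols_def)
  then show ?thesis by (simp add: column_list_def)
qed

lemma length_coordinate_list:
  assumes "M \<in> carrier_mat I R" "1 \<le> P"
  shows "length (coordinate_list R P M D) = (2 * I + 2 * P - 1) * R"
proof -
  have "length (concat (map (\<lambda>m. map Re (list_of_vec m) @ map Im (list_of_vec m)) (cols M)))
      = (2 * I) * length (cols M)"
    by (rule length_concat_const) (use assms in \<open>auto simp: cols_def\<close>)
  moreover obtain Q where "P = Suc Q" using assms(2) by (cases P) auto
  ultimately show ?thesis using assms(1)
    by (simp add: coordinate_list_def length_column_list D_bar_def algebra_simps)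
qed

lemma coordinates_in_space:
  assumes "M \<in> carrier_mat I R" "1 \<le> P"
  shows "coordinates R P M D \<in> space (lebesgue_on_nat ((2 * I + 2 * P - 1) * R))"
  using length_coordinate_list[OF assms]
  by (simp add: coordinates_def lebesgue_on_nat_def space_PiM Let_def)

section \<open>Elementary properties of the system\<close>

lemma mat_adjoint_dims [simp]:
  "dim_row (mat_adjoint A) = dim_col A" "dim_col (mat_adjoint A) = dim_row A"
  by (simp_all add: mat_adjoint_def)

lemma mat_adjoint_entry [simp]:
  fixes A :: "complex mat"
  shows "i < dim_col A \<Longrightarrow> j < dim_row A \<Longrightarrow> mat_adjoint A $$ (i, j) = cnj (A $$ (j, i))"
  by (simp add: mat_adjoint_def mat_of_rows_def)

lemma system_entry:
  assumes M: "M \<in> carrier_mat I R" and D: "D \<in> carrier_mat R R" "diagonal_mat D"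
    and "i < I" "j < I"
  shows "(M * D * mat_adjoint M) $$ (i, j)
       = (\<Sum>r<R. D $$ (r, r) * (M $$ (i, r) * cnj (M $$ (j, r))))"
proof -
  have *: "(M * D) $$ (i, r) = M $$ (i, r) * D $$ (r, r)" if "r < R" for r
  proof -
    have "(M * D) $$ (i, r) = (\<Sum>k\<in>{0..<R}. M $$ (i, k) * D $$ (k, r))"
      using assms that by (auto simp: scalar_prod_def)
    also have "\<dots> = (\<Sum>k\<in>{0..<R}. if k = r then M $$ (i, r) * D $$ (r, r) else 0)"
      by (rule sum.cong) (use D that in \<open>auto simp: diagonal_mat_def\<close>)
    also have "\<dots> = M $$ (i, r) * D $$ (r, r)" using that by simp
    finally show ?thesis .
  qed
  have "(M * D * mat_adjoint M) $$ (i, j)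
      = (\<Sum>r\<in>{0..<R}. (M * D) $$ (i, r) * mat_adjoint M $$ (r, j))"
    using assms by (auto simp: scalar_prod_def)
  also have "\<dots> = (\<Sum>r<R. D $$ (r, r) * (M $$ (i, r) * cnj (M $$ (j, r))))"
    unfolding atLeast0LessThan
    by (rule sum.cong) (use M assms(5) * in \<open>auto simp: mult_ac\<close>)
  finally show ?thesis .
qed

lemma real_diag_conj:
  assumes "A \<in> carrier_mat R R"
  shows "real_diag R f * A * real_diag R f
       = mat R R (\<lambda>(i, j). complex_of_real (f i) * A $$ (i, j) * complex_of_real (f j))"
proof -
  have A: "real_diag R f * A \<in> carrier_mat R R" using assms by (intro mult_carrier_mat) auto
  show ?thesis
    by (subst mat_diag_mult_right[OF A], subst mat_diag_mult_left[OF assms])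
      (rule eq_matI; auto)
qed

lemma is_solution_rescale:
  assumes sol: "is_solution I R P C M D" and s: "\<And>r. r < R \<Longrightarrow> 0 < s r" and "1 \<le> P"
  shows "is_solution I R P C (M * real_diag R s)
           (\<lambda>p. real_diag R (\<lambda>r. 1 / s r) * D p * real_diag R (\<lambda>r. 1 / s r))"
    (is "is_solution I R P C ?M ?D")
proof -
  have M: "M \<in> carrier_mat I R" and D1: "\<And>r. r < R \<Longrightarrow> D 1 $$ (r, r) \<in> \<real>"
    and D: "\<And>p. p \<in> {1..P} \<Longrightarrow> D p \<in> carrier_mat R R \<and> diagonal_mat (D p)"
    and C: "\<And>p. p \<in> {1..P} \<Longrightarrow> C p = M * D p * mat_adjoint M"
    using sol by (auto simp: is_solution_def parameters_def)
  have M': "?M = mat I R (\<lambda>(i, j). M $$ (i, j) * complex_of_real (s j))"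
    by (rule mat_diag_mult_right[OF M])
  have D': "?D p = mat R R (\<lambda>(i, j). complex_of_real (1 / s i) * D p $$ (i, j) * complex_of_real (1 / s j))"
    if "p \<in> {1..P}" for p
    using D[OF that] by (intro real_diag_conj) auto
  have diag: "?D p \<in> carrier_mat R R \<and> diagonal_mat (?D p)" if "p \<in> {1..P}" for p
    using D[OF that] unfolding D'[OF that] by (auto simp: diagonal_mat_def)
  have Mc: "?M \<in> carrier_mat I R" unfolding M' by simp
  have "?D 1 $$ (r, r) \<in> \<real>" if "r < R" for r
    using D'[of 1] D1[OF that] that \<open>1 \<le> P\<close> by (auto intro!: Reals_mult)
  moreover have "C p = ?M * ?D p * mat_adjoint ?M" if p: "p \<in> {1..P}" for p
  proof (rule eq_matI)
    fix i j assume "i < dim_row (?M * ?D p * mat_adjoint ?M)" "j < dim_col (?M * ?D p * mat_adjoint ?M)"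
    then have ij: "i < I" "j < I" using M by auto
    have "(?M * ?D p * mat_adjoint ?M) $$ (i, j)
        = (\<Sum>r<R. ?D p $$ (r, r) * (?M $$ (i, r) * cnj (?M $$ (j, r))))"
      using diag[OF p] Mc ij by (intro system_entry) auto
    also have "\<dots> = (\<Sum>r<R. D p $$ (r, r) * (M $$ (i, r) * cnj (M $$ (j, r))))"
    proof (rule sum.cong, rule refl)
      fix r assume "r \<in> {..<R}"
      then have "s r \<noteq> 0" "r < R" using s[of r] by auto
      then show "?D p $$ (r, r) * (?M $$ (i, r) * cnj (?M $$ (j, r)))
          = D p $$ (r, r) * (M $$ (i, r) * cnj (M $$ (j, r)))"
        unfolding D'[OF p] M' using ij by (simp add: field_simps)
    qed
    also have "\<dots> = (M * D p * mat_adjoint M) $$ (i, j)"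
      using D[OF p] M ij by (intro system_entry[symmetric]) auto
    finally show "C p $$ (i, j) = (?M * ?D p * mat_adjoint ?M) $$ (i, j)"
      using C[OF p] by simp
  qed (use C[OF p] M in auto)
  ultimately show ?thesis
    using diag Mc by (simp add: is_solution_def parameters_def)
qed

lemma diagonal_unitary_cmod:
  assumes "diagonal_unitary R L" "r < R"
  shows "cmod (L $$ (r, r)) = 1"
proof -
  have L: "L \<in> carrier_mat R R" "diagonal_mat L" "L * mat_adjoint L = 1\<^sub>m R"
    using assms by (auto simp: diagonal_unitary_def)
  have "1 = (L * mat_adjoint L) $$ (r, r)" using L(3) assms(2) by simp
  also have "\<dots> = (\<Sum>k\<in>{0..<R}. L $$ (r, k) * cnj (L $$ (r, k)))"
    using L(1) assms(2) by (auto simp: scalar_prod_def)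
  also have "\<dots> = (\<Sum>k\<in>{0..<R}. if k = r then L $$ (r, r) * cnj (L $$ (r, r)) else 0)"
    by (rule sum.cong) (use L assms(2) in \<open>auto simp: diagonal_mat_def\<close>)
  also have "\<dots> = L $$ (r, r) * cnj (L $$ (r, r))" using assms(2) by simp
  finally have "complex_of_real ((cmod (L $$ (r, r)))\<^sup>2) = 1"
    by (simp only: complex_norm_square)
  then have "(cmod (L $$ (r, r)))\<^sup>2 = 1" by (simp only: of_real_eq_1_iff)
  then show ?thesis using power2_eq_iff_nonneg[of "cmod (L $$ (r, r))" 1] by simp
qed

lemma trivially_related_normalized:
  assumes rel: "trivially_related R P M D M' D'"
    and M: "M \<in> carrier_mat I R"
    and D: "\<And>p. p \<in> {1..P} \<Longrightarrow> D p \<in> carrier_mat R R"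
    and norm: "\<And>r. r < R \<Longrightarrow> (\<Sum>i<I. (cmod (M $$ (i, r)))\<^sup>2) = 1"
    and norm': "\<And>r. r < R \<Longrightarrow> (\<Sum>i<I. (cmod (M' $$ (i, r)))\<^sup>2) = 1"
  shows "\<exists>Q L. permutation_matrix R Q \<and> diagonal_unitary R L \<and> M' = M * L * Q \<and>
           (\<forall>p\<in>{1..P}. D' p = transpose_mat Q * D p * Q)"
proof -
  obtain Q L s where Q: "permutation_matrix R Q" and L: "diagonal_unitary R L"
    and s: "\<And>r. r < R \<Longrightarrow> 0 < s r" and M': "M' = M * L * real_diag R s * Q"
    and D': "\<And>p. p \<in> {1..P} \<Longrightarrow> D' p =
      transpose_mat Q * (real_diag R (\<lambda>r. 1 / s r) * D p * real_diag R (\<lambda>r. 1 / s r)) * Q"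
    using rel unfolding trivially_related_def by blast
  obtain \<pi> where \<pi>: "\<pi> permutes {..<R}" and Qdef: "Q = mat R R (\<lambda>(i, j). if i = \<pi> j then 1 else 0)"
    using Q by (auto simp: permutation_matrix_def)
  have Lc: "L \<in> carrier_mat R R" "diagonal_mat L" using L by (auto simp: diagonal_unitary_def)
  have prod_entry: "(M * L) $$ (i, r) = M $$ (i, r) * L $$ (r, r)" if "i < I" "r < R" for i r
  proof -
    have "(M * L) $$ (i, r) = (\<Sum>k\<in>{0..<R}. M $$ (i, k) * L $$ (k, r))"
      using M Lc that by (auto simp: scalar_prod_def)
    also have "\<dots> = (\<Sum>k\<in>{0..<R}. if k = r then M $$ (i, r) * L $$ (r, r) else 0)"
      by (rule sum.cong) (use Lc that in \<open>auto simp: diagonal_mat_def\<close>)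
    finally show ?thesis using that by simp
  qed
  have prod_carrier: "M * L \<in> carrier_mat I R" using M Lc(1) by auto
  note scaled = mat_diag_mult_right[OF prod_carrier, of "\<lambda>r. complex_of_real (s r)"]
  have entry: "M' $$ (i, r) = M $$ (i, \<pi> r) * L $$ (\<pi> r, \<pi> r) * complex_of_real (s (\<pi> r))"
    if "i < I" "r < R" for i r
  proof -
    have pr: "\<pi> r < R" using permutes_in_image[OF \<pi>, of r] that by auto
    have "M' $$ (i, r) = (\<Sum>k\<in>{0..<R}. (M * L) $$ (i, k) * complex_of_real (s k) * (if k = \<pi> r then 1 else 0))"
      unfolding M' scaled Qdef using that by (simp add: scalar_prod_def)
    also have "\<dots> = (\<Sum>k\<in>{0..<R}. if k = \<pi> r then (M * L) $$ (i, \<pi> r) * complex_of_real (s (\<pi> r)) else 0)"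
      by (rule sum.cong) auto
    also have "\<dots> = (M * L) $$ (i, \<pi> r) * complex_of_real (s (\<pi> r))" using pr by simp
    finally show ?thesis using prod_entry[OF that(1) pr] by simp
  qed
  have s1: "s k = 1" if "k < R" for k
  proof -
    have "k \<in> \<pi> ` {..<R}" using permutes_image[OF \<pi>] that by simp
    then obtain r where r: "r < R" "\<pi> r = k" by blast
    have sq: "(cmod (M' $$ (i, r)))\<^sup>2 = (cmod (M $$ (i, k)))\<^sup>2 * (s k)\<^sup>2" if "i < I" for i
      unfolding entry[OF that r(1)] r(2)
      by (simp add: norm_mult power_mult_distrib diagonal_unitary_cmod[OF L \<open>k < R\<close>])
    have "1 = (\<Sum>i<I. (cmod (M' $$ (i, r)))\<^sup>2)" using norm'[OF r(1)] by simp
    also have "\<dots> = (\<Sum>i<I. (cmod (M $$ (i, k)))\<^sup>2 * (s k)\<^sup>2)"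
      using sq by (intro sum.cong) auto
    also have "\<dots> = (\<Sum>i<I. (cmod (M $$ (i, k)))\<^sup>2) * (s k)\<^sup>2"
      by (rule sum_distrib_right[symmetric])
    also have "\<dots> = (s k)\<^sup>2" by (simp only: norm[OF that] mult_1)
    finally show ?thesis using s[OF that] power2_eq_iff_nonneg[of "s k" 1] by simp
  qed
  have S: "real_diag R s = 1\<^sub>m R" "real_diag R (\<lambda>r. 1 / s r) = 1\<^sub>m R"
    using s1 by (auto simp: mat_diag_def)
  have "M' = M * L * Q" unfolding M' S right_mult_one_mat[OF prod_carrier] ..
  moreover have "D' p = transpose_mat Q * D p * Q" if "p \<in> {1..P}" for p
    unfolding D'[OF that] S left_mult_one_mat[OF D[OF that]] right_mult_one_mat[OF D[OF that]] ..
  ultimately show ?thesis using Q L by blast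
qed

end

theory Submission
  imports Defs
begin

text \<open>For almost every point of \<open>\<real>\<^sup>n\<close> each partial derivative \<open>\<partial>/\<partial>\<xi>\<^sub>i\<close> is a well-defined derivation of
  the ring generated by the coordinates, and it extends to any finitely many further reals. Such
  derivations replace transversality: a relation \<open>x x\<^sup>H = \<Sum>r. l\<^sub>r m\<^sub>r m\<^sub>r\<^sup>H\<close> may be differentiated with
  respect to the entries of the \<open>m\<^sub>r\<close>, whatever \<open>x\<close> and \<open>l\<^sub>r\<close> are. If at most \<open>(I - 1)\<^sup>2\<close> terms occur,
  some matrix \<open>Y \<noteq> 0\<close> is orthogonal to all \<open>m\<^sub>r m\<^sub>r\<^sup>H\<close> and to the tangent space at \<open>x x\<^sup>H\<close>. The
  differentiated relation then forces \<open>Y m\<^sub>r = 0\<close> whenever \<open>l\<^sub>r \<noteq> 0\<close>, which is impossible once \<open>I\<close> or more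
  of the \<open>l\<^sub>r\<close> are nonzero; with fewer, the \<open>m\<^sub>r\<close> are linearly independent and only one term can
  occur. Hence the span of the \<open>m\<^sub>r m\<^sub>r\<^sup>H\<close> contains no rank-one matrix \<open>x x\<^sup>H\<close> except their multiples.
  As \<open>R \<le> 2 P - 1\<close>, the \<open>2 P - 1\<close> real slices of the \<open>C\<^sub>p\<close> span the same space, so every solution
  consists of these rank-one matrices.\<close>

section \<open>Homogeneous linear systems\<close>

text \<open>Gaussian elimination, by induction on the equations. Arbitrary finite index sets allow
  equations indexed by disjoint sums and unknowns indexed by pairs.\<close>

lemma homogeneous_solution:
  fixes a :: "'q \<Rightarrow> 'x \<Rightarrow> 'k::field"
  assumes "finite Q" "finite X" "card Q < card X"
  shows "\<exists>y. (\<exists>x\<in>X. y x \<noteq> 0) \<and> (\<forall>q\<in>Q. (\<Sum>x\<in>X. a q x * y x) = 0)"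
  using assms
proof (induction Q arbitrary: X a rule: finite_induct)
  case empty
  then have "X \<noteq> {}" by auto
  then show ?case by (intro exI[of _ "\<lambda>_. 1"]) auto
next
  case (insert q Q)
  show ?case
  proof (cases "\<forall>x\<in>X. a q x = 0")
    case True
    obtain y where "\<exists>x\<in>X. y x \<noteq> 0" "\<forall>q\<in>Q. (\<Sum>x\<in>X. a q x * y x) = 0"
      using insert.IH[of X a] insert.prems insert.hyps by auto
    then show ?thesis using True by (intro exI[of _ y]) auto
  next
    case False
    then obtain p where p: "p \<in> X" "a q p \<noteq> 0" by blast
    define X' where "X' = X - {p}"
    have X': "finite X'" "p \<notin> X'" "X = insert p X'" "card Q < card X'"
      using insert.prems insert.hyps p by (auto simp: X'_def)
    \<comment> \<open>Equation \<open>q\<close>, with pivot \<open>a q p\<close>, eliminates the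
      unknown \<open>p\<close>; \<open>z\<close> below recovers its value from the other
      unknowns.\<close>
    define a' where "a' q' x = a q' x - a q' p * a q x / a q p" for q' x
    obtain y where y: "\<exists>x\<in>X'. y x \<noteq> 0" "\<And>q'. q' \<in> Q \<Longrightarrow> (\<Sum>x\<in>X'. a' q' x * y x) = 0"
      using insert.IH[of X' a'] X' by auto
    define z where "z x = (if x = p then - (\<Sum>x\<in>X'. a q x * y x) / a q p else y x)" for x
    have split: "(\<Sum>x\<in>X. a q' x * z x)
        = (\<Sum>x\<in>X'. a q' x * y x) - a q' p * (\<Sum>x\<in>X'. a q x * y x) / a q p" for q'
    proof -
      have "(\<Sum>x\<in>X. a q' x * z x) = a q' p * z p + (\<Sum>x\<in>X'. a q' x * z x)"
        unfolding X'(3) using X'(1,2) by simp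
      also have "(\<Sum>x\<in>X'. a q' x * z x) = (\<Sum>x\<in>X'. a q' x * y x)"
        using X'(2) by (intro sum.cong) (auto simp: z_def)
      finally show ?thesis by (simp add: z_def)
    qed
    have "(\<Sum>x\<in>X. a q' x * z x) = (\<Sum>x\<in>X'. a' q' x * y x)" for q'
      unfolding split a'_def
      by (simp add: algebra_simps sum_subtractf sum_distrib_left sum_divide_distrib)
    then have "\<forall>q'\<in>insert q Q. (\<Sum>x\<in>X. a q' x * z x) = 0"
      using y(2) split[of q] p(2) by auto
    moreover have "\<exists>x\<in>X. z x \<noteq> 0" using y(1) X' by (auto simp: z_def)
    ultimately show ?thesis by blast
  qed
qed

section \<open>Derivations of subrings\<close>

text \<open>\<open>A\<close> is a subring, and \<open>D\<close> takes values in the whole ring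
  rather than in \<open>A\<close>: extending a derivation to a further element may introduce
  quotients.\<close>

definition derivation_on :: "'a::comm_ring_1 set \<Rightarrow> ('a \<Rightarrow> 'a) \<Rightarrow> bool" where
  "derivation_on A D \<longleftrightarrow> 1 \<in> A \<and> (\<forall>a\<in>A. - a \<in> A) \<and>
     (\<forall>a\<in>A. \<forall>b\<in>A. a + b \<in> A \<and> a * b \<in> A \<and>
        D (a + b) = D a + D b \<and> D (a * b) = a * D b + b * D a)"

context
  fixes A :: "'a::comm_ring_1 set" and D
  assumes D: "derivation_on A D"
begin

lemma derivation_on_closed:
  shows "1 \<in> A" and "0 \<in> A" and "a \<in> A \<Longrightarrow> - a \<in> A"
    and "a \<in> A \<Longrightarrow> b \<in> A \<Longrightarrow> a + b \<in> A"
    and "a \<in> A \<Longrightarrow> b \<in> A \<Longrightarrow> a - b \<in> A"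
    and "a \<in> A \<Longrightarrow> b \<in> A \<Longrightarrow> a * b \<in> A"
proof -
  show 1: "1 \<in> A" and *: "a \<in> A \<Longrightarrow> - a \<in> A" for a using D by (auto simp: derivation_on_def)
  show **: "a \<in> A \<Longrightarrow> b \<in> A \<Longrightarrow> a + b \<in> A" for a b using D by (auto simp: derivation_on_def)
  show "a \<in> A \<Longrightarrow> b \<in> A \<Longrightarrow> a * b \<in> A" using D by (auto simp: derivation_on_def)
  show "0 \<in> A" using **[OF 1 *[OF 1]] by simp
  show "a \<in> A \<Longrightarrow> b \<in> A \<Longrightarrow> a - b \<in> A" using **[OF _ *, of a b] by simp
qed

lemma derivation_on_add: "a \<in> A \<Longrightarrow> b \<in> A \<Longrightarrow> D (a + b) = D a + D b"
  and derivation_on_mult: "a \<in> A \<Longrightarrow> b \<in> A \<Longrightarrow> D (a * b) = a * D b + b * D a"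
  using D by (auto simp: derivation_on_def)

lemma derivation_on_0: "D 0 = 0"
  using derivation_on_add[of 0 0] derivation_on_closed by simp

lemma derivation_on_1: "D 1 = 0"
  using derivation_on_mult[of 1 1] derivation_on_closed by simp

lemma derivation_on_minus: "a \<in> A \<Longrightarrow> D (- a) = - D a"
  using derivation_on_add[of a "- a"] derivation_on_closed derivation_on_0
  by (simp add: eq_neg_iff_add_eq_0 add.commute)

lemma derivation_on_sum_closed: "(\<And>i. i \<in> X \<Longrightarrow> f i \<in> A) \<Longrightarrow> sum f X \<in> A"
  by (induction X rule: infinite_finite_induct) (auto intro: derivation_on_closed)

lemma derivation_on_sum: "(\<And>i. i \<in> X \<Longrightarrow> f i \<in> A) \<Longrightarrow> D (sum f X) = (\<Sum>i\<in>X. D (f i))"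
  by (induction X rule: infinite_finite_induct)
    (simp_all add: derivation_on_0 derivation_on_add derivation_on_sum_closed)

text \<open>Applying \<open>D\<close> to the coefficients is again a derivation. In
  \<open>derivation_extend\<close> it contributes the part of the derivative of
  \<open>poly p a\<close> that comes from the coefficients.\<close>

lemma map_poly_derivation_mult:
  assumes "\<And>i. coeff p i \<in> A" "\<And>i. coeff q i \<in> A"
  shows "map_poly D (p * q) = p * map_poly D q + map_poly D p * q"
proof (rule poly_eqI)
  fix n
  have "coeff (map_poly D (p * q)) n = D (\<Sum>i\<le>n. coeff p i * coeff q (n - i))"
    by (simp add: coeff_map_poly derivation_on_0 coeff_mult)
  also have "\<dots> = (\<Sum>i\<le>n. D (coeff p i * coeff q (n - i)))"
    by (rule derivation_on_sum) (simp add: assms derivation_on_closed)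
  also have "\<dots> = (\<Sum>i\<le>n. coeff p i * D (coeff q (n - i)) + D (coeff p i) * coeff q (n - i))"
    by (rule sum.cong) (simp_all add: assms derivation_on_mult mult.commute)
  finally show "coeff (map_poly D (p * q)) n = coeff (p * map_poly D q + map_poly D p * q) n"
    by (simp add: coeff_mult sum.distrib coeff_map_poly derivation_on_0)
qed

end

text \<open>The elements of the ring generated by \<open>A\<close> and \<open>a\<close> are the
  values \<open>poly p a\<close>, and the extension must send such a value to \<open>ev c p\<close>,
  where \<open>c\<close> is the derivative chosen for \<open>a\<close>. This is well defined once
  \<open>ev c p\<close> vanishes whenever \<open>poly p a\<close> does. For \<open>a\<close>
  transcendental over \<open>A\<close> any \<open>c\<close> works; otherwise an annihilating
  polynomial of least degree dictates \<open>c\<close>, and characteristic 0 makes its equation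
  solvable.\<close>

lemma derivation_extend:
  fixes A :: "'a::field_char_0 set"
  assumes D: "derivation_on A D"
  shows "\<exists>B E. derivation_on B E \<and> insert a A \<subseteq> B \<and> (\<forall>x\<in>A. E x = D x)"
proof -
  define AX where "AX = {p. \<forall>i. coeff p i \<in> A}"
  define ev where "ev c p = poly (map_poly D p) a + poly (pderiv p) a * c" for c p
  note cl = derivation_on_closed[OF D]
  have coeff_D: "coeff (map_poly D p) i = D (coeff p i)" for p i
    by (simp add: coeff_map_poly derivation_on_0[OF D])
  have AX_add: "p + q \<in> AX" and AX_diff: "p - q \<in> AX" if "p \<in> AX" "q \<in> AX" for p q
    using that cl by (auto simp: AX_def)
  have AX_minus: "- p \<in> AX" if "p \<in> AX" for p using that cl by (auto simp: AX_def)
  have AX_mult: "p * q \<in> AX" if "p \<in> AX" "q \<in> AX" for p q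
    using that by (auto simp: AX_def coeff_mult intro!: derivation_on_sum_closed[OF D] cl)
  have AX_monom: "monom x n \<in> AX" if "x \<in> A" for x n using that cl by (auto simp: AX_def)
  have ev_add: "ev c (p + q) = ev c p + ev c q" if "p \<in> AX" "q \<in> AX" for c p q
  proof -
    have "map_poly D (p + q) = map_poly D p + map_poly D q"
      using that by (intro poly_eqI) (auto simp: coeff_D AX_def derivation_on_add[OF D])
    then show ?thesis by (simp add: ev_def pderiv_add algebra_simps)
  qed
  have ev_mult: "ev c (p * q) = poly p a * ev c q + poly q a * ev c p"
    if "p \<in> AX" "q \<in> AX" for c p q
    using map_poly_derivation_mult[OF D, of p q] that
    by (simp add: ev_def AX_def pderiv_mult algebra_simps)
  have ev_const: "ev c (monom x 0) = D x" for c x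
    by (simp add: ev_def pderiv_monom map_poly_monom derivation_on_0[OF D] poly_monom)
  have ev_0: "ev c 0 = 0" for c by (simp add: ev_def)
  have ev_minus: "ev c (- p) = - ev c p" if "p \<in> AX" for c p
    using ev_add[OF that AX_minus[OF that], of c] ev_0
    by (simp add: eq_neg_iff_add_eq_0 add.commute)
  have ev_diff: "ev c (p - q) = ev c p - ev c q" if "p \<in> AX" "q \<in> AX" for c p q
    using ev_add[OF that(1) AX_minus[OF that(2)], of c] ev_minus[OF that(2), of c] by simp
  have "\<exists>c. \<forall>p\<in>AX. poly p a = 0 \<longrightarrow> ev c p = 0"
  proof (cases "\<exists>p\<in>AX. poly p a = 0 \<and> p \<noteq> 0")
    case False
    then show ?thesis by (metis ev_0)
  next
    case True
    define f where "f = arg_min degree (\<lambda>p. p \<in> AX \<and> poly p a = 0 \<and> p \<noteq> 0)"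
    have f: "f \<in> AX" "poly f a = 0" "f \<noteq> 0"
      and min: "\<And>p. p \<in> AX \<Longrightarrow> poly p a = 0 \<Longrightarrow> p \<noteq> 0 \<Longrightarrow> degree f \<le> degree p"
      using True arg_min_nat_lemma[of "\<lambda>p. p \<in> AX \<and> poly p a = 0 \<and> p \<noteq> 0" _ degree]
      by (auto simp: f_def)
    have deg: "degree f > 0"
      using f(2,3) by (auto elim!: degree_eq_zeroE intro!: gr0I)
    have "of_nat n * x \<in> A" if "x \<in> A" for n x
      using that by (induction n) (auto simp: distrib_right intro: cl)
    then have "pderiv f \<in> AX" using f(1) by (auto simp: AX_def coeff_pderiv simp del: of_nat_Suc)
    moreover have "pderiv f \<noteq> 0" using deg by (simp add: pderiv_eq_0_iff)
    \<comment> \<open>The derivative is nonzero and of smaller degree, so by minimality it cannot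
      vanish at \<open>a\<close>; hence \<open>ev c f = 0\<close> can be solved for
      \<open>c\<close>.\<close>
    ultimately have f': "poly (pderiv f) a \<noteq> 0"
      using min[of "pderiv f"] deg by (auto simp: degree_pderiv)
    define c where "c = - poly (map_poly D f) a / poly (pderiv f) a"
    have ev_f: "ev c f = 0" using f' by (simp add: ev_def c_def)
    have "ev c p = 0" if "p \<in> AX" "poly p a = 0" for p
      using that
    proof (induction "degree p" arbitrary: p rule: less_induct)
      case less
      show ?case
      proof (cases "p = 0")
        case True
        then show ?thesis by (auto simp: ev_0)
      next
        case False
        have le: "degree f \<le> degree p" using min less.prems False by auto
        define g where "g = monom (lead_coeff p) (degree p - degree f)"
        \<comment> \<open>Pseudo-division: \<open>A\<close> need not contain the inverse of the
          leading coefficient of \<open>f\<close>, so \<open>p\<close> is multiplied by that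
          coefficient before the leading terms are cancelled.\<close>
        define q where "q = monom (lead_coeff f) 0 * p - g * f"
        have g: "g \<in> AX" and l: "monom (lead_coeff f) 0 \<in> AX"
          using less.prems f by (auto simp: g_def AX_def cl)
        have q: "q \<in> AX" "poly q a = 0"
          using less.prems f g l by (auto simp: q_def intro!: AX_diff AX_mult)
        have "ev c q = 0"
        proof (cases "q = 0")
          case True
          then show ?thesis by (auto simp: ev_0)
        next
          case False
          have "coeff q (degree p) = 0"
            using le by (simp add: q_def g_def coeff_monom_mult mult.commute[of "lead_coeff f"])
          moreover have "coeff q i = 0" if "i > degree p" for i
            using that le by (auto simp: q_def g_def coeff_monom_mult coeff_eq_0)
          ultimately have "coeff q i = 0" if "i \<ge> degree p" for i
            using that by (cases "i = degree p") auto
          moreover have "coeff q (degree q) \<noteq> 0" using False by simp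
          ultimately have "degree q < degree p" by (meson not_le)
          then show ?thesis using less.hyps q by auto
        qed
        moreover have "ev c q = lead_coeff f * ev c p"
          unfolding q_def using less.prems f g l ev_f
          by (simp add: ev_diff ev_mult AX_mult poly_monom)
        ultimately show ?thesis using f(3) by simp
      qed
    qed
    then show ?thesis by blast
  qed
  then obtain c where c: "\<And>p. p \<in> AX \<Longrightarrow> poly p a = 0 \<Longrightarrow> ev c p = 0" by blast
  define E where "E x = ev c (SOME p. p \<in> AX \<and> poly p a = x)" for x
  have E: "E (poly p a) = ev c p" if "p \<in> AX" for p
  proof -
    define q where "q = (SOME q. q \<in> AX \<and> poly q a = poly p a)"
    have q: "q \<in> AX \<and> poly q a = poly p a"
      unfolding q_def by (rule someI[of _ p]) (use that in auto)
    then show ?thesis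
      using c[of "q - p"] ev_diff[of q p c] AX_diff[of q p] that by (simp add: E_def q_def)
  qed
  define B where "B = (\<lambda>p. poly p a) ` AX"
  have "derivation_on B E"
    unfolding derivation_on_def
  proof (intro conjI ballI)
    show "1 \<in> B" unfolding B_def
      using AX_monom[OF cl(1), of 0] by (intro image_eqI[of _ _ "monom 1 0"]) (auto simp: poly_monom)
  next
    fix x assume "x \<in> B"
    then show "- x \<in> B" unfolding B_def using AX_minus by (force simp flip: poly_minus)
  next
    fix x y assume "x \<in> B" "y \<in> B"
    then obtain p q where pq: "p \<in> AX" "q \<in> AX" "x = poly p a" "y = poly q a"
      by (auto simp: B_def)
    show "x + y \<in> B" "x * y \<in> B"
      using AX_add[OF pq(1,2)] AX_mult[OF pq(1,2)] by (force simp: pq(3,4) B_def)+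
    show "E (x + y) = E x + E y"
      using E[OF AX_add[OF pq(1,2)]] by (simp add: pq E ev_add)
    show "E (x * y) = x * E y + y * E x"
      using E[OF AX_mult[OF pq(1,2)]] by (simp add: pq E ev_mult)
  qed
  moreover have "a \<in> B"
    unfolding B_def using AX_monom[OF cl(1), of 1]
    by (intro image_eqI[of _ _ "monom 1 1"]) (auto simp: poly_monom)
  moreover have "x \<in> B" "E x = D x" if "x \<in> A" for x
    using E[OF AX_monom[OF that, of 0]] AX_monom[OF that, of 0] ev_const[of c x]
    by (force simp: B_def poly_monom)+
  ultimately show ?thesis by blast
qed

lemma derivation_extend_finite:
  fixes A :: "'a::field_char_0 set"
  assumes "finite F" "derivation_on A D"
  shows "\<exists>B E. derivation_on B E \<and> F \<union> A \<subseteq> B \<and> (\<forall>x\<in>A. E x = D x)"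
  using assms
proof (induction F rule: finite_induct)
  case empty
  then show ?case by auto
next
  case (insert a F)
  then obtain B E where "derivation_on B E" "F \<union> A \<subseteq> B" "\<forall>x\<in>A. E x = D x" by blast
  moreover obtain B' E' where "derivation_on B' E'" "insert a B \<subseteq> B'" "\<forall>x\<in>B. E' x = E x"
    using derivation_extend[OF \<open>derivation_on B E\<close>] by blast
  ultimately show ?case by (intro exI[of _ B'] exI[of _ E']) auto
qed

section \<open>Points at which polynomial relations can be differentiated\<close>

text \<open>Terms for the polynomials with integer coefficients. There are only countably many, so
  the non-generic points form a countable union of sets, each given by one term and one
  index.\<close>

datatype poly_term = Var nat | One | Neg poly_term | Add poly_term poly_term | Mul poly_term poly_term

instance poly_term :: countable by countable_datatype

fun poly_eval :: "poly_term \<Rightarrow> (nat \<Rightarrow> real) \<Rightarrow> real" where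
  "poly_eval (Var j) \<xi> = \<xi> j"
| "poly_eval One \<xi> = 1"
| "poly_eval (Neg t) \<xi> = - poly_eval t \<xi>"
| "poly_eval (Add s t) \<xi> = poly_eval s \<xi> + poly_eval t \<xi>"
| "poly_eval (Mul s t) \<xi> = poly_eval s \<xi> * poly_eval t \<xi>"

fun partial :: "nat \<Rightarrow> poly_term \<Rightarrow> (nat \<Rightarrow> real) \<Rightarrow> real" where
  "partial i (Var j) \<xi> = (if j = i then 1 else 0)"
| "partial i One \<xi> = 0"
| "partial i (Neg t) \<xi> = - partial i t \<xi>"
| "partial i (Add s t) \<xi> = partial i s \<xi> + partial i t \<xi>"
| "partial i (Mul s t) \<xi> = poly_eval s \<xi> * partial i t \<xi> + poly_eval t \<xi> * partial i s \<xi>"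

text \<open>A point with algebraically independent coordinates is generic in this sense; the weaker
  condition suffices for the partial derivatives to be well defined on the ring generated by
  the coordinates, and its failure is visibly a null set.\<close>

definition generic_point :: "nat \<Rightarrow> (nat \<Rightarrow> real) \<Rightarrow> bool" where
  "generic_point n \<xi> \<longleftrightarrow> (\<forall>t. \<forall>i<n. poly_eval t \<xi> = 0 \<longrightarrow> partial i t \<xi> = 0)"

text \<open>Two terms with the same value differ by a term of value 0, whose partial derivative
  vanishes at a generic point. So the partial derivative depends on the value alone and is a
  derivation of the ring generated by the coordinates, which extends to \<open>F\<close>.\<close>

lemma generic_point_derivation:
  assumes \<xi>: "generic_point n \<xi>" and "i < n" and "finite F"
  shows "\<exists>B E. derivation_on B E \<and> F \<subseteq> B \<and>
           (\<forall>j. \<xi> j \<in> B \<and> E (\<xi> j) = (if j = i then 1 else 0))"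
proof -
  define A where "A = range (\<lambda>t. poly_eval t \<xi>)"
  define D where "D x = partial i (SOME t. poly_eval t \<xi> = x) \<xi>" for x
  have D: "D (poly_eval t \<xi>) = partial i t \<xi>" for t
  proof -
    define s where "s = (SOME s. poly_eval s \<xi> = poly_eval t \<xi>)"
    have "poly_eval s \<xi> = poly_eval t \<xi>" unfolding s_def by (rule someI[of _ t]) simp
    then have "poly_eval (Add s (Neg t)) \<xi> = 0" by simp
    then have "partial i (Add s (Neg t)) \<xi> = 0"
      using \<xi> \<open>i < n\<close> unfolding generic_point_def by blast
    then show ?thesis by (simp add: D_def s_def)
  qed
  have "derivation_on A D"
    unfolding derivation_on_def
  proof (intro conjI ballI)
    show "1 \<in> A" unfolding A_def by (rule range_eqI[of _ _ One]) simp
  next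
    fix x assume "x \<in> A"
    then obtain t where "x = poly_eval t \<xi>" by (auto simp: A_def)
    then show "- x \<in> A" unfolding A_def by (intro range_eqI[of _ _ "Neg t"]) simp
  next
    fix x y assume "x \<in> A" "y \<in> A"
    then obtain s t where st: "x = poly_eval s \<xi>" "y = poly_eval t \<xi>" by (auto simp: A_def)
    show "x + y \<in> A" unfolding A_def st by (rule range_eqI[of _ _ "Add s t"]) simp
    show "x * y \<in> A" unfolding A_def st by (rule range_eqI[of _ _ "Mul s t"]) simp
    show "D (x + y) = D x + D y" using D[of "Add s t"] D[of s] D[of t] by (simp add: st)
    show "D (x * y) = x * D y + y * D x" using D[of "Mul s t"] D[of s] D[of t] by (simp add: st)
  qed
  then obtain B E where BE: "derivation_on B E" "F \<union> A \<subseteq> B" "\<forall>x\<in>A. E x = D x"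
    using derivation_extend_finite[OF \<open>finite F\<close>] by blast
  have "\<xi> j \<in> A" for j unfolding A_def by (rule range_eqI[of _ _ "Var j"]) simp
  then show ?thesis using BE D[of "Var _"] by (intro exI[of _ B] exI[of _ E]) auto
qed

section \<open>Non-generic points form a null set\<close>

fun line_poly :: "(nat \<Rightarrow> real) \<Rightarrow> nat \<Rightarrow> poly_term \<Rightarrow> real poly" where
  "line_poly \<xi> i (Var j) = (if j = i then [:0, 1:] else [:\<xi> j:])"
| "line_poly \<xi> i One = 1"
| "line_poly \<xi> i (Neg t) = - line_poly \<xi> i t"
| "line_poly \<xi> i (Add s t) = line_poly \<xi> i s + line_poly \<xi> i t"
| "line_poly \<xi> i (Mul s t) = line_poly \<xi> i s * line_poly \<xi> i t"

lemma poly_line_poly: "poly (line_poly \<xi> i t) y = poly_eval t (\<xi>(i := y))"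
  by (induction t) auto

lemma poly_pderiv_line_poly: "poly (pderiv (line_poly \<xi> i t)) y = partial i t (\<xi>(i := y))"
  by (induction t) (auto simp: pderiv_pCons pderiv_minus pderiv_add pderiv_mult poly_line_poly simp del: fun_upd_apply)

text \<open>If the restriction to the line is the zero polynomial, its derivative vanishes too;
  otherwise it has only finitely many roots.\<close>

lemma finite_singular_on_line:
  "finite {y. poly_eval t (\<xi>(i := y)) = 0 \<and> partial i t (\<xi>(i := y)) \<noteq> 0}"
proof (cases "line_poly \<xi> i t = 0")
  case True
  then have "partial i t (\<xi>(i := y)) = 0" for y
    using poly_pderiv_line_poly[of \<xi> i t y] by simp
  then show ?thesis by simp
next
  case False
  have "{y. poly_eval t (\<xi>(i := y)) = 0 \<and> partial i t (\<xi>(i := y)) \<noteq> 0}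
      \<subseteq> {y. poly (line_poly \<xi> i t) y = 0}"
    by (auto simp: poly_line_poly)
  then show ?thesis using poly_roots_finite[OF False] finite_subset by blast
qed

lemma measurable_coordinate:
  "(\<lambda>\<xi>. \<xi> j) \<in> borel_measurable (\<Pi>\<^sub>M k\<in>{..<n::nat}. (lborel :: real measure))"
proof (cases "j < n")
  case True
  then show ?thesis using measurable_component_singleton[of j "{..<n}" "\<lambda>_. lborel"] by simp
next
  case False
  \<comment> \<open>Points of the product space take the value \<open>undefined\<close> outside
    \<open>{..<n}\<close>, so this coordinate is constant there.\<close>
  then have "(\<lambda>\<xi>. \<xi> j) \<in> borel_measurable (\<Pi>\<^sub>M k\<in>{..<n::nat}. (lborel :: real measure)) \<longleftrightarrow>
      (\<lambda>\<xi>. undefined :: real) \<in> borel_measurable (\<Pi>\<^sub>M k\<in>{..<n::nat}. (lborel :: real measure))"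
    by (intro measurable_cong) (auto simp: space_PiM PiE_def extensional_def)
  then show ?thesis by simp
qed

lemma measurable_poly_eval [measurable]:
  "poly_eval t \<in> borel_measurable (\<Pi>\<^sub>M k\<in>{..<n::nat}. lborel)"
  by (induction t) (simp_all add: measurable_coordinate)

lemma measurable_partial [measurable]:
  "partial i t \<in> borel_measurable (\<Pi>\<^sub>M k\<in>{..<n::nat}. lborel)"
  by (induction t) simp_all

text \<open>Fubini: coordinate \<open>i\<close> is integrated out first, and each line in that
  direction meets the set in finitely many points.\<close>

lemma null_singular:
  assumes "i < n"
  shows "{\<xi> \<in> space (\<Pi>\<^sub>M k\<in>{..<n}. lborel). poly_eval t \<xi> = 0 \<and> partial i t \<xi> \<noteq> 0}
           \<in> null_sets (\<Pi>\<^sub>M k\<in>{..<n}. lborel)"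
    (is "?N \<in> null_sets ?M")
proof -
  interpret product_sigma_finite "\<lambda>_::nat. lborel :: real measure" by standard
  define J where "J = {..<n} - {i}"
  have J: "finite J" "i \<notin> J" "{..<n} = insert i J" using assms by (auto simp: J_def)
  have N: "?N \<in> sets ?M" by measurable
  have zero: "(\<integral>\<^sup>+ y. indicator ?N (\<xi>(i := y)) \<partial>lborel) = 0" for \<xi>
  proof -
    let ?Z = "{y. poly_eval t (\<xi>(i := y)) = 0 \<and> partial i t (\<xi>(i := y)) \<noteq> 0}"
    have fin: "finite ?Z" by (rule finite_singular_on_line)
    have "(\<integral>\<^sup>+ y. indicator ?N (\<xi>(i := y)) \<partial>lborel) \<le> (\<integral>\<^sup>+ y. indicator ?Z y \<partial>lborel)"
      by (rule nn_integral_mono) (auto simp: indicator_def)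
    also have "\<dots> = emeasure lborel ?Z"
      using fin by (intro nn_integral_indicator) (simp add: finite_imp_closed borel_closed)
    also have "\<dots> = 0" using fin by (intro emeasure_lborel_countable countable_finite)
    finally show ?thesis by simp
  qed
  have "emeasure ?M ?N = (\<integral>\<^sup>+ \<xi>. indicator ?N \<xi> \<partial>?M)" using N by simp
  also have "\<dots> = (\<integral>\<^sup>+ \<xi>. (\<integral>\<^sup>+ y. indicator ?N (\<xi>(i := y)) \<partial>lborel) \<partial>(\<Pi>\<^sub>M k\<in>J. lborel))"
    using N unfolding J(3) by (intro product_nn_integral_insert[OF J(1,2)]) simp
  also have "\<dots> = 0" by (simp only: zero) simp
  finally show ?thesis using N by (simp add: null_sets_def)
qed

lemma null_not_generic:
  "{\<xi> \<in> space (lebesgue_on_nat n). \<not> generic_point n \<xi>} \<in> null_sets (lebesgue_on_nat n)"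
proof -
  let ?M = "\<Pi>\<^sub>M k\<in>{..<n}. (lborel :: real measure)"
  have "{\<xi> \<in> space ?M. \<not> generic_point n \<xi>}
      = (\<Union>t. \<Union>i\<in>{..<n}. {\<xi> \<in> space ?M. poly_eval t \<xi> = 0 \<and> partial i t \<xi> \<noteq> 0})"
    by (auto simp: generic_point_def)
  also have "\<dots> \<in> null_sets ?M"
    by (intro null_sets_UN' null_singular) auto
  finally have "{\<xi> \<in> space ?M. \<not> generic_point n \<xi>} \<in> null_sets (completion ?M)"
    by (rule null_sets_completionI)
  then show ?thesis by (simp add: lebesgue_on_nat_def)
qed

section \<open>Matrices with independently differentiable entries\<close>

text \<open>The derivation acts as the partial derivative with respect to the entry
  \<open>A s k\<close>. \<open>F\<close> is meant to hold the quantities of the relation to be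
  differentiated; nothing is assumed about how they depend on the entries, and the entries
  themselves are put into \<open>F\<close> when they occur.\<close>

definition independent_entries :: "'r set \<Rightarrow> 'j set \<Rightarrow> ('r \<Rightarrow> 'j \<Rightarrow> 'a::field) \<Rightarrow> bool" where
  "independent_entries S J A \<longleftrightarrow>
     (\<forall>F s k. finite F \<longrightarrow> s \<in> S \<longrightarrow> k \<in> J \<longrightarrow>
        (\<exists>B E. derivation_on B E \<and> F \<subseteq> B \<and>
           (\<forall>r\<in>S. \<forall>j\<in>J. E (A r j) = (if r = s \<and> j = k then 1 else 0))))"

lemma independent_entries_subset:
  fixes A :: "'r \<Rightarrow> 'j \<Rightarrow> 'a::field"
  assumes "independent_entries S J A" "S' \<subseteq> S" "J' \<subseteq> J"
  shows "independent_entries S' J' A"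
  unfolding independent_entries_def
proof (intro allI impI)
  fix F :: "'a set" and s k assume "finite F" "s \<in> S'" "k \<in> J'"
  then have "\<exists>B E. derivation_on B E \<and> F \<subseteq> B \<and>
      (\<forall>r\<in>S. \<forall>j\<in>J. E (A r j) = (if r = s \<and> j = k then 1 else 0))"
    using assms(1)[unfolded independent_entries_def, rule_format, of F s k] assms(2,3) by blast
  then show "\<exists>B E. derivation_on B E \<and> F \<subseteq> B \<and>
      (\<forall>r\<in>S'. \<forall>j\<in>J'. E (A r j) = (if r = s \<and> j = k then 1 else 0))"
    by (elim ex_forward) (use assms(2,3) in \<open>simp add: subset_eq\<close>)
qed

text \<open>Differentiating the relation \<open>\<Sum>j. u j * A r j = 0\<close>, normalised to \<open>u k = 1\<close>, confines the
  derivatives of the entries in column \<open>k\<close> to a proper subspace.\<close>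

lemma independent_entries_kernel:
  assumes ind: "independent_entries S J A" and fin: "finite S" "finite J" and card: "card J \<le> card S"
    and rel: "\<And>r. r \<in> S \<Longrightarrow> (\<Sum>j\<in>J. w j * A r j) = 0" and k: "k \<in> J"
  shows "w k = 0"
proof (rule ccontr)
  assume wk: "w k \<noteq> 0"
  define u where "u j = w j / w k" for j
  have u: "u k = 1" "\<And>r. r \<in> S \<Longrightarrow> (\<Sum>j\<in>J. u j * A r j) = 0"
    using wk rel by (simp_all add: u_def flip: sum_divide_distrib)
  \<comment> \<open>There are fewer columns besides \<open>k\<close> than rows, so some nonzero
    \<open>y\<close> is orthogonal to all of these columns.\<close>
  have "card (J - {k}) < card S"
    using card k fin card_Diff1_less[of J k] by linarith
  then obtain y where y: "\<exists>r\<in>S. y r \<noteq> 0" "\<forall>j\<in>J - {k}. (\<Sum>r\<in>S. A r j * y r) = 0"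
    using homogeneous_solution[of "J - {k}" S "\<lambda>j r. A r j"] fin by blast
  then obtain s where s: "s \<in> S" "y s \<noteq> 0" by blast
  define F where "F = u ` J \<union> (\<lambda>(r, j). A r j) ` (S \<times> J)"
  have "finite F" using fin by (simp add: F_def)
  then obtain B E where BE: "derivation_on B E" "F \<subseteq> B"
    and E: "\<And>r j. r \<in> S \<Longrightarrow> j \<in> J \<Longrightarrow> E (A r j) = (if r = s \<and> j = k then 1 else 0)"
    using ind[unfolded independent_entries_def, rule_format, OF \<open>finite F\<close> s(1) k] by auto
  have inB: "u j \<in> B" "r \<in> S \<Longrightarrow> A r j \<in> B" if "j \<in> J" for r j
    using that BE(2) by (auto simp: F_def)
  have Erel: "(\<Sum>j\<in>J. A r j * E (u j)) = - (if r = s then 1 else 0)" if r: "r \<in> S" for r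
  proof -
    have "0 = E (\<Sum>j\<in>J. u j * A r j)" using u(2)[OF r] derivation_on_0[OF BE(1)] by simp
    also have "\<dots> = (\<Sum>j\<in>J. E (u j * A r j))"
      by (rule derivation_on_sum[OF BE(1)]) (rule derivation_on_closed(6)[OF BE(1) inB(1) inB(2)[OF _ r]])
    also have "\<dots> = (\<Sum>j\<in>J. u j * E (A r j) + A r j * E (u j))"
      by (rule sum.cong[OF refl]) (rule derivation_on_mult[OF BE(1) inB(1) inB(2)[OF _ r]])
    also have "\<dots> = (\<Sum>j\<in>J. u j * E (A r j)) + (\<Sum>j\<in>J. A r j * E (u j))"
      by (rule sum.distrib)
    also have "(\<Sum>j\<in>J. u j * E (A r j)) = (\<Sum>j\<in>J. if j = k then if r = s then 1 else 0 else 0)"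
      using E[OF r] u(1) by (intro sum.cong) auto
    also have "\<dots> = (if r = s then 1 else 0)" using k fin by simp
    finally show ?thesis by (simp add: eq_neg_iff_add_eq_0 add.commute)
  qed
  have "- y s = (\<Sum>r\<in>S. if r = s then - y r else 0)"
    using s fin by simp
  also have "\<dots> = (\<Sum>r\<in>S. y r * (\<Sum>j\<in>J. A r j * E (u j)))"
    by (rule sum.cong[OF refl]) (simp add: Erel)
  also have "\<dots> = (\<Sum>j\<in>J. E (u j) * (\<Sum>r\<in>S. A r j * y r))"
    unfolding sum_distrib_left by (subst sum.swap) (simp add: mult_ac)
  also have "\<dots> = 0"
  proof (rule sum.neutral, rule ballI)
    fix j assume "j \<in> J"
    \<comment> \<open>For \<open>j = k\<close> the first factor is the derivative of 1; for the
      other columns the second vanishes by the choice of \<open>y\<close>.\<close>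
    then show "E (u j) * (\<Sum>r\<in>S. A r j * y r) = 0"
      using y(2) u(1) derivation_on_1[OF BE(1)] by (cases "j = k") simp_all
  qed
  finally show False using s(2) by simp
qed

text \<open>\<open>w\<close> separates row \<open>s\<close> from the other rows. It solves one
  equation fewer than there are unknowns; were row \<open>s\<close> killed as well, a square matrix
  with independent entries would have a kernel.\<close>

lemma independent_entries_dual:
  assumes ind: "independent_entries S J A" and fin: "finite S" "finite J" and card: "card S \<le> card J"
    and s: "s \<in> S"
  shows "\<exists>w. (\<forall>r\<in>S - {s}. (\<Sum>j\<in>J. w j * A r j) = 0) \<and> (\<Sum>j\<in>J. w j * A s j) \<noteq> 0"
proof -
  \<comment> \<open>The columns are cut down to exactly \<open>card S\<close>, because
    \<open>independent_entries_kernel\<close> requires at least as many rows as columns.\<close>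
  obtain J' where J': "J' \<subseteq> J" "card J' = card S"
    using card by (meson obtain_subset_with_card_n)
  have fin': "finite J'" using J' fin finite_subset by blast
  have "card (S - {s}) < card J'" using s fin J' card_Diff1_less[of S s] by simp
  then obtain y where y: "\<exists>j\<in>J'. y j \<noteq> 0" "\<forall>r\<in>S - {s}. (\<Sum>j\<in>J'. A r j * y j) = 0"
    using homogeneous_solution[of "S - {s}" J' A] fin fin' by blast
  define w where "w j = (if j \<in> J' then y j else 0)" for j
  have w: "(\<Sum>j\<in>J. w j * A r j) = (\<Sum>j\<in>J'. A r j * y j)" for r
    using J' fin by (intro sum.mono_neutral_cong_right) (auto simp: w_def)
  have "(\<Sum>j\<in>J'. A s j * y j) \<noteq> 0"
  proof
    assume "(\<Sum>j\<in>J'. A s j * y j) = 0"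
    then have *: "(\<Sum>j\<in>J'. y j * A r j) = 0" if "r \<in> S" for r
      using y(2) that by (cases "r = s") (auto simp: mult.commute)
    have "y j = 0" if "j \<in> J'" for j
      by (rule independent_entries_kernel[OF independent_entries_subset[OF ind subset_refl J'(1)]
            fin(1) fin' _ * that]) (simp_all add: J'(2))
    then show False using y(1) by blast
  qed
  then show ?thesis using y(2) unfolding w[symmetric] by blast
qed

lemma generic_independent_entries:
  assumes \<xi>: "generic_point n \<xi>"
    and A: "\<And>r j. r \<in> S \<Longrightarrow> j \<in> J \<Longrightarrow> A r j = \<xi> (f r j) \<and> f r j < n"
    and inj: "\<And>r j s k. r \<in> S \<Longrightarrow> j \<in> J \<Longrightarrow> s \<in> S \<Longrightarrow> k \<in> J \<Longrightarrow> f r j = f s k \<Longrightarrow> r = s \<and> j = k"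
  shows "independent_entries S J A"
  unfolding independent_entries_def
proof (intro allI impI)
  fix F :: "real set" and s k assume "finite F" and sk: "s \<in> S" "k \<in> J"
  have "f s k < n" using A[OF sk] by simp
  obtain B E where BE: "derivation_on B E" "F \<subseteq> B"
    "\<forall>j. \<xi> j \<in> B \<and> E (\<xi> j) = (if j = f s k then 1 else 0)"
    using generic_point_derivation[OF \<xi> \<open>f s k < n\<close> \<open>finite F\<close>] by (elim exE conjE) (rule that)
  have "E (A r j) = (if r = s \<and> j = k then 1 else 0)" if "r \<in> S" "j \<in> J" for r j
    using A[OF that] BE(3)[rule_format, of "f r j"] inj[OF that sk] by auto
  then show "\<exists>B E. derivation_on B E \<and> F \<subseteq> B \<and>
           (\<forall>r\<in>S. \<forall>j\<in>J. E (A r j) = (if r = s \<and> j = k then 1 else 0))"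
    using BE(1,2) by blast
qed

section \<open>Derivations that commute with complex conjugation\<close>

definition cnj_derivation_on :: "complex set \<Rightarrow> (complex \<Rightarrow> complex) \<Rightarrow> bool" where
  "cnj_derivation_on B E \<longleftrightarrow>
     derivation_on B E \<and> (\<forall>z\<in>B. cnj z \<in> B \<and> E (cnj z) = cnj (E z))"

text \<open>The values 1 and \<open>\<i>\<close> of \<open>c\<close> stand for differentiation with
  respect to the real and the imaginary part of the entry.\<close>

definition cnj_independent_entries :: "'r set \<Rightarrow> 'j set \<Rightarrow> ('r \<Rightarrow> 'j \<Rightarrow> complex) \<Rightarrow> bool" where
  "cnj_independent_entries S J A \<longleftrightarrow>
     (\<forall>F s k. \<forall>c\<in>{1, \<i>}. finite F \<longrightarrow> s \<in> S \<longrightarrow> k \<in> J \<longrightarrow>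
        (\<exists>B E. cnj_derivation_on B E \<and> F \<subseteq> B \<and>
           (\<forall>r\<in>S. \<forall>j\<in>J. E (A r j) = (if r = s \<and> j = k then c else 0))))"

lemma cnj_independent_entries_subset:
  assumes "cnj_independent_entries S J A" "S' \<subseteq> S" "J' \<subseteq> J"
  shows "cnj_independent_entries S' J' A"
  unfolding cnj_independent_entries_def
proof (intro allI ballI impI)
  fix F :: "complex set" and s k and c :: complex
  assume "c \<in> {1, \<i>}" "finite F" "s \<in> S'" "k \<in> J'"
  then have "\<exists>B E. cnj_derivation_on B E \<and> F \<subseteq> B \<and>
      (\<forall>r\<in>S. \<forall>j\<in>J. E (A r j) = (if r = s \<and> j = k then c else 0))"
    using assms(1)[unfolded cnj_independent_entries_def, rule_format, of c F s k] assms(2,3) by blast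
  then show "\<exists>B E. cnj_derivation_on B E \<and> F \<subseteq> B \<and>
      (\<forall>r\<in>S'. \<forall>j\<in>J'. E (A r j) = (if r = s \<and> j = k then c else 0))"
    by (elim ex_forward) (use assms(2,3) in \<open>simp add: subset_eq\<close>)
qed

lemma cnj_independent_entries_imp:
  assumes "cnj_independent_entries S J A"
  shows "independent_entries S J A"
  unfolding independent_entries_def
proof (intro allI impI)
  fix F :: "complex set" and s k assume "finite F" "s \<in> S" "k \<in> J"
  from assms[unfolded cnj_independent_entries_def, rule_format, OF insertI1 this]
  show "\<exists>B E. derivation_on B E \<and> F \<subseteq> B \<and>
      (\<forall>r\<in>S. \<forall>j\<in>J. E (A r j) = (if r = s \<and> j = k then 1 else 0))"
    unfolding cnj_derivation_on_def by (elim ex_forward) simp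
qed

lemma complexify_derivation:
  assumes D: "derivation_on B D"
  shows "cnj_derivation_on {z. Re z \<in> B \<and> Im z \<in> B} (\<lambda>z. Complex (D (Re z)) (D (Im z)))"
proof -
  note cl = derivation_on_closed[OF D]
  have diff: "D (a - b) = D a - D b" if "a \<in> B" "b \<in> B" for a b
    using derivation_on_add[OF D that(1) cl(3)[OF that(2)]] derivation_on_minus[OF D that(2)] by simp
  show ?thesis
    unfolding cnj_derivation_on_def derivation_on_def
    by (auto simp: complex_eq_iff cl diff derivation_on_add[OF D] derivation_on_mult[OF D]
        derivation_on_minus[OF D] algebra_simps)
qed

lemma generic_cnj_independent_entries:
  assumes \<xi>: "generic_point n \<xi>"
    and A: "\<And>r j. r \<in> S \<Longrightarrow> j \<in> J \<Longrightarrow>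
      A r j = Complex (\<xi> (f r j False)) (\<xi> (f r j True)) \<and> f r j False < n \<and> f r j True < n"
    and inj: "\<And>r j a s k b. r \<in> S \<Longrightarrow> j \<in> J \<Longrightarrow> s \<in> S \<Longrightarrow> k \<in> J \<Longrightarrow> f r j a = f s k b \<Longrightarrow>
      r = s \<and> j = k \<and> a = b"
  shows "cnj_independent_entries S J A"
  unfolding cnj_independent_entries_def
proof (intro allI impI ballI)
  fix F :: "complex set" and s k and c :: complex
  assume "finite F" and sk: "s \<in> S" "k \<in> J" and c: "c \<in> {1, \<i>}"
  \<comment> \<open>The Boolean argument selects the coordinate of the imaginary part exactly when
    \<open>c\<close> is \<open>\<i>\<close>.\<close>
  define i where "i = f s k (c = \<i>)"
  have "i < n" using A[OF sk] by (cases "c = \<i>") (auto simp: i_def)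
  have "finite (Re ` F \<union> Im ` F)" using \<open>finite F\<close> by simp
  then obtain B D where BD: "derivation_on B D" "Re ` F \<union> Im ` F \<subseteq> B"
    "\<forall>j. \<xi> j \<in> B \<and> D (\<xi> j) = (if j = i then 1 else 0)"
    using generic_point_derivation[OF \<xi> \<open>i < n\<close> \<open>finite (Re ` F \<union> Im ` F)\<close>]
    by (elim exE conjE) (rule that)
  have "Complex (D (Re (A r j))) (D (Im (A r j))) = (if r = s \<and> j = k then c else 0)"
    if "r \<in> S" "j \<in> J" for r j
  proof -
    have "f r j b = i \<longleftrightarrow> r = s \<and> j = k \<and> b = (c = \<i>)" for b
      using inj[OF that sk, of b "c = \<i>"] by (auto simp: i_def)
    then have "D (Re (A r j)) = (if r = s \<and> j = k \<and> c \<noteq> \<i> then 1 else 0)"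
      "D (Im (A r j)) = (if r = s \<and> j = k \<and> c = \<i> then 1 else 0)"
      using A[OF that] BD(3) by simp_all
    then show ?thesis using c by (elim insertE) (simp_all add: complex_eq_iff)
  qed
  then show "\<exists>B E. cnj_derivation_on B E \<and> F \<subseteq> B \<and>
           (\<forall>r\<in>S. \<forall>j\<in>J. E (A r j) = (if r = s \<and> j = k then c else 0))"
    using BD(2) complexify_derivation[OF BD(1)]
    by (intro exI[of _ "{z. Re z \<in> B \<and> Im z \<in> B}"]
        exI[of _ "\<lambda>z. Complex (D (Re z)) (D (Im z))"] conjI) (simp_all add: subset_eq)
qed

section \<open>Rank-one matrices in the span of generic ones\<close>

text \<open>Both sides are evaluated as sesquilinear forms at \<open>v\<close> and \<open>w\<close>;
  with dual vectors in place of \<open>v\<close> and \<open>w\<close>, single terms on the right can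
  be isolated.\<close>

lemma sesquilinear_form_rank_one:
  fixes m :: "'r \<Rightarrow> 'j \<Rightarrow> complex"
  assumes "\<And>i j. i \<in> J \<Longrightarrow> j \<in> J \<Longrightarrow> x i * cnj (x j) = (\<Sum>r\<in>S. l r * (m r i * cnj (m r j)))"
  shows "(\<Sum>i\<in>J. v i * x i) * cnj (\<Sum>j\<in>J. w j * x j)
       = (\<Sum>r\<in>S. l r * ((\<Sum>i\<in>J. v i * m r i) * cnj (\<Sum>j\<in>J. w j * m r j)))"
proof -
  have "(\<Sum>i\<in>J. v i * x i) * cnj (\<Sum>j\<in>J. w j * x j)
      = (\<Sum>i\<in>J. \<Sum>j\<in>J. v i * cnj (w j) * (x i * cnj (x j)))"
    by (simp add: sum_product mult_ac)
  also have "\<dots> = (\<Sum>i\<in>J. \<Sum>j\<in>J. \<Sum>r\<in>S. l r * (v i * m r i * cnj (w j * m r j)))"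
    using assms by (intro sum.cong refl) (simp add: sum_distrib_left mult_ac)
  also have "\<dots> = (\<Sum>r\<in>S. \<Sum>i\<in>J. \<Sum>j\<in>J. l r * (v i * m r i * cnj (w j * m r j)))"
    by (subst sum.swap[of _ S], subst sum.swap[of _ S]) simp
  also have "\<dots> = (\<Sum>r\<in>S. l r * ((\<Sum>i\<in>J. v i * m r i) * cnj (\<Sum>j\<in>J. w j * m r j)))"
    unfolding cnj_sum sum_product unfolding sum_distrib_left ..
  finally show ?thesis .
qed

text \<open>Orthogonality to a rank-one matrix \<open>x x\<^sup>H\<close> and to its tangent space only costs
  \<open>2 |J| - 1\<close> equations.\<close>

lemma exists_normal_matrix:
  fixes m :: "'r \<Rightarrow> 'j \<Rightarrow> complex"
  assumes fin: "finite S" "finite J" and J: "J \<noteq> {}"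
    and card: "card S < (card J - 1)\<^sup>2"
  shows "\<exists>Y. (\<exists>i\<in>J. \<exists>j\<in>J. Y i j \<noteq> 0) \<and>
    (\<forall>i\<in>J. (\<Sum>j\<in>J. Y i j * x j) = 0) \<and>
    (\<forall>j\<in>J. (\<Sum>i\<in>J. Y i j * cnj (x i)) = 0) \<and>
    (\<forall>r\<in>S. (\<Sum>i\<in>J. \<Sum>j\<in>J. Y i j * (m r j * cnj (m r i))) = 0)"
proof -
  \<comment> \<open>If \<open>x\<close> is nonzero on \<open>J\<close>, then \<open>a\<close> is an
    index where it is nonzero.\<close>
  obtain a where a: "a \<in> J" "x a = 0 \<Longrightarrow> \<forall>j\<in>J. x j = 0" using J by blast
  \<comment> \<open>The equations: all rows, all columns but \<open>a\<close>, and the elements of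
    \<open>S\<close>. Their number \<open>2 * card J - 1 + card S\<close> is below
    \<open>(card J)\<^sup>2\<close>.\<close>
  define Q where "Q = J <+> ((J - {a}) <+> S)"
  define c where "c q p = (case q of
      Inl i \<Rightarrow> if fst p = i then x (snd p) else 0
    | Inr (Inl j) \<Rightarrow> if snd p = j then cnj (x (fst p)) else 0
    | Inr (Inr r) \<Rightarrow> m r (snd p) * cnj (m r (fst p)))" for q p
  have "card Q < card (J \<times> J)"
  proof -
    obtain N where N: "card J = Suc N" using J fin by (metis card_0_eq not0_implies_Suc)
    have "card Q = card J + (card J - 1 + card S)"
      using fin a by (simp add: Q_def card_Plus card_Diff_singleton)
    then show ?thesis using card by (simp add: N power2_eq_square card_cartesian_product)
  qed
  then obtain y where y: "\<exists>p\<in>J \<times> J. y p \<noteq> 0" "\<forall>q\<in>Q. (\<Sum>p\<in>J \<times> J. c q p * y p) = 0"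
    using homogeneous_solution[of Q "J \<times> J" c] fin by (auto simp: Q_def)
  define Y where "Y i j = y (i, j)" for i j
  have eq: "(\<Sum>i\<in>J. \<Sum>j\<in>J. Y i j * c q (i, j)) = 0" if "q \<in> Q" for q
    using y(2) that by (simp add: sum.cartesian_product' Y_def mult.commute)
  have row: "(\<Sum>j\<in>J. Y i j * x j) = 0" if i: "i \<in> J" for i
  proof -
    have "0 = (\<Sum>k\<in>J. \<Sum>j\<in>J. Y k j * c (Inl i) (k, j))"
      by (rule eq[symmetric]) (use i in \<open>auto simp: Q_def\<close>)
    also have "\<dots> = (\<Sum>k\<in>J. if k = i then \<Sum>j\<in>J. Y i j * x j else 0)"
      by (intro sum.cong) (auto simp: c_def)
    finally show ?thesis using i fin by simp
  qed
  have col': "(\<Sum>i\<in>J. Y i j * cnj (x i)) = 0" if j: "j \<in> J - {a}" for j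
  proof -
    have "0 = (\<Sum>i\<in>J. \<Sum>k\<in>J. Y i k * c (Inr (Inl j)) (i, k))"
      by (rule eq[symmetric]) (use j in \<open>auto simp: Q_def\<close>)
    also have "\<dots> = (\<Sum>i\<in>J. \<Sum>k\<in>J. if k = j then Y i j * cnj (x i) else 0)"
      by (intro sum.cong) (auto simp: c_def)
    finally show ?thesis using j fin by simp
  qed
  \<comment> \<open>The omitted equation for column \<open>a\<close> follows from the others:
    evaluating the form \<open>Y\<close> at \<open>x\<close> by columns leaves only this one, by
    rows it gives 0.\<close>
  have "x a * (\<Sum>i\<in>J. Y i a * cnj (x i)) = (\<Sum>j\<in>J. x j * (\<Sum>i\<in>J. Y i j * cnj (x i)))"
    using a fin col' by (simp add: sum.remove[of J a])
  also have "\<dots> = (\<Sum>i\<in>J. cnj (x i) * (\<Sum>j\<in>J. Y i j * x j))"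
    unfolding sum_distrib_left by (subst sum.swap) (simp add: mult_ac)
  also have "\<dots> = 0" using row by simp
  finally have "(\<Sum>i\<in>J. Y i a * cnj (x i)) = 0"
    using a(2) by (cases "x a = 0") auto
  then have "(\<Sum>i\<in>J. Y i j * cnj (x i)) = 0" if "j \<in> J" for j
    using col' that by (cases "j = a") auto
  moreover have "(\<Sum>i\<in>J. \<Sum>j\<in>J. Y i j * (m r j * cnj (m r i))) = 0" if "r \<in> S" for r
    using eq[of "Inr (Inr r)"] that by (auto simp: Q_def c_def)
  moreover have "\<exists>i\<in>J. \<exists>j\<in>J. Y i j \<noteq> 0" using y(1) by (auto simp: Y_def)
  ultimately show ?thesis using row by (intro exI[of _ Y]) simp
qed

text \<open>Differentiating \<open>x x\<^sup>H = \<Sum>r. l r * m\<^sub>r m\<^sub>r\<^sup>H\<close> in the direction of a single entry of a single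
  \<open>m\<^sub>s\<close> and pairing the result with \<open>Y\<close>.\<close>

lemma normal_matrix_annihilates:
  fixes m :: "'r \<Rightarrow> 'j \<Rightarrow> complex"
  assumes ind: "cnj_independent_entries S J m" and fin: "finite S" "finite J"
    and eq: "\<And>i j. i \<in> J \<Longrightarrow> j \<in> J \<Longrightarrow> x i * cnj (x j) = (\<Sum>r\<in>S. l r * (m r i * cnj (m r j)))"
    and row: "\<And>i. i \<in> J \<Longrightarrow> (\<Sum>j\<in>J. Y i j * x j) = 0"
    and col: "\<And>j. j \<in> J \<Longrightarrow> (\<Sum>i\<in>J. Y i j * cnj (x i)) = 0"
    and quad: "\<And>r. r \<in> S \<Longrightarrow> (\<Sum>i\<in>J. \<Sum>j\<in>J. Y i j * (m r j * cnj (m r i))) = 0"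
    and s: "s \<in> S" "l s \<noteq> 0" and k: "k \<in> J"
  shows "(\<Sum>j\<in>J. Y k j * m s j) = 0"
proof -
  have delta: "(\<Sum>i\<in>J. \<Sum>j\<in>J. (if i = k then f j else 0) + (if j = k then g i else 0))
      = (\<Sum>j\<in>J. f j) + (\<Sum>i\<in>J. g i)" for f g :: "'j \<Rightarrow> complex"
  proof -
    have "(\<Sum>i\<in>J. \<Sum>j\<in>J. if i = k then f j else 0) = (\<Sum>j\<in>J. \<Sum>i\<in>J. if i = k then f j else 0)"
      by (rule sum.swap)
    then show ?thesis using k fin by (simp add: sum.distrib)
  qed
  define U where "U = (\<Sum>i\<in>J. Y i k * cnj (m s i))"
  define V where "V = (\<Sum>j\<in>J. Y k j * m s j)"
  have UV: "c * U + cnj c * V = 0" if c: "c \<in> {1, \<i>}" for c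
  proof -
    define F where "F = x ` J \<union> l ` S \<union> (\<lambda>(r, j). m r j) ` (S \<times> J)"
    have "finite F" using fin by (simp add: F_def)
    from ind[unfolded cnj_independent_entries_def, rule_format, OF c this s(1) k]
    obtain B E where BE: "cnj_derivation_on B E" "F \<subseteq> B"
      and E: "\<forall>r\<in>S. \<forall>j\<in>J. E (m r j) = (if r = s \<and> j = k then c else 0)"
      by (elim exE conjE) (rule that)
    have D: "derivation_on B E" and cnjB: "\<And>z. z \<in> B \<Longrightarrow> cnj z \<in> B"
      and cnjE: "\<And>z. z \<in> B \<Longrightarrow> E (cnj z) = cnj (E z)"
      using BE(1) by (auto simp: cnj_derivation_on_def)
    have xB: "x j \<in> B" if "j \<in> J" for j using BE(2) that by (auto simp: F_def)
    have lB: "l r \<in> B" if "r \<in> S" for r using BE(2) that by (auto simp: F_def)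
    have mB: "m r j \<in> B" if "r \<in> S" "j \<in> J" for r j using BE(2) that by (auto simp: F_def)
    note mult = derivation_on_mult[OF D] and cl = derivation_on_closed(6)[OF D]
    have E_eq: "x j * cnj (E (x i)) + cnj (x i) * E (x j)
        = (\<Sum>r\<in>S. l r * (m r j * cnj (E (m r i)) + cnj (m r i) * E (m r j))
              + m r j * cnj (m r i) * E (l r))" if ij: "i \<in> J" "j \<in> J" for i j
    proof -
      have "x j * cnj (E (x i)) + cnj (x i) * E (x j) = E (x j * cnj (x i))"
        by (simp add: mult xB cnjB cnjE ij)
      also have "\<dots> = E (\<Sum>r\<in>S. l r * (m r j * cnj (m r i)))"
        by (simp only: eq[OF ij(2,1)])
      also have "\<dots> = (\<Sum>r\<in>S. E (l r * (m r j * cnj (m r i))))"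
        by (rule derivation_on_sum[OF D]) (simp add: cl lB mB cnjB ij)
      also have "\<dots> = (\<Sum>r\<in>S. l r * (m r j * cnj (E (m r i)) + cnj (m r i) * E (m r j))
              + m r j * cnj (m r i) * E (l r))"
        by (rule sum.cong[OF refl]) (simp add: mult cl lB mB cnjB cnjE ij)
      finally show ?thesis .
    qed
    \<comment> \<open>The derivative of \<open>x x\<^sup>H\<close> is tangent, so \<open>Y\<close>
      pairs to 0 with it whatever \<open>E (x i)\<close> may be.\<close>
    have "(\<Sum>i\<in>J. \<Sum>j\<in>J. Y i j * (x j * cnj (E (x i)) + cnj (x i) * E (x j)))
        = (\<Sum>i\<in>J. \<Sum>j\<in>J. cnj (E (x i)) * (Y i j * x j))
          + (\<Sum>i\<in>J. \<Sum>j\<in>J. E (x j) * (Y i j * cnj (x i)))"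
      by (simp add: sum.distrib algebra_simps)
    also have "(\<Sum>i\<in>J. \<Sum>j\<in>J. cnj (E (x i)) * (Y i j * x j))
        = (\<Sum>i\<in>J. cnj (E (x i)) * (\<Sum>j\<in>J. Y i j * x j))"
      unfolding sum_distrib_left ..
    also have "(\<Sum>i\<in>J. \<Sum>j\<in>J. E (x j) * (Y i j * cnj (x i)))
        = (\<Sum>j\<in>J. E (x j) * (\<Sum>i\<in>J. Y i j * cnj (x i)))"
      unfolding sum_distrib_left by (rule sum.swap)
    finally have "0 = (\<Sum>i\<in>J. \<Sum>j\<in>J. Y i j * (x j * cnj (E (x i)) + cnj (x i) * E (x j)))"
      by (simp add: row col)
    also have "\<dots> = (\<Sum>i\<in>J. \<Sum>j\<in>J. \<Sum>r\<in>S.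
        l r * (Y i j * (m r j * cnj (E (m r i)) + cnj (m r i) * E (m r j)))
        + E (l r) * (Y i j * (m r j * cnj (m r i))))"
      by (intro sum.cong refl) (simp add: E_eq sum_distrib_left algebra_simps)
    also have "\<dots> = (\<Sum>r\<in>S. \<Sum>i\<in>J. \<Sum>j\<in>J.
        l r * (Y i j * (m r j * cnj (E (m r i)) + cnj (m r i) * E (m r j)))
        + E (l r) * (Y i j * (m r j * cnj (m r i))))"
      by (subst sum.swap[of _ S], subst sum.swap[of _ S]) simp
    also have "\<dots> = (\<Sum>r\<in>S.
        l r * (\<Sum>i\<in>J. \<Sum>j\<in>J. Y i j * (m r j * cnj (E (m r i)) + cnj (m r i) * E (m r j)))
        + E (l r) * (\<Sum>i\<in>J. \<Sum>j\<in>J. Y i j * (m r j * cnj (m r i))))"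
      by (simp add: sum_distrib_left sum.distrib)
    also have "\<dots> = (\<Sum>r\<in>S. if r = s then l s * (c * U + cnj c * V) else 0)"
    proof (rule sum.cong[OF refl])
      \<comment> \<open>The unknown derivatives \<open>E (l r)\<close> disappear because
        \<open>Y\<close> is orthogonal to every \<open>m\<^sub>r m\<^sub>r\<^sup>H\<close>; among
        the derivatives of the vectors only the entry \<open>k\<close> of \<open>m s\<close>
        contributes.\<close>
      fix r assume r: "r \<in> S"
      have "(\<Sum>i\<in>J. \<Sum>j\<in>J. Y i j * (m r j * cnj (E (m r i)) + cnj (m r i) * E (m r j)))
          = (\<Sum>i\<in>J. \<Sum>j\<in>J. (if i = k then if r = s then cnj c * (Y k j * m s j) else 0 else 0)
              + (if j = k then if r = s then c * (Y i k * cnj (m s i)) else 0 else 0))"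
        by (intro sum.cong refl) (simp add: E r algebra_simps)
      also have "\<dots> = (if r = s then c * U + cnj c * V else 0)"
        unfolding delta by (simp add: U_def V_def sum_distrib_left add.commute)
      finally show "l r * (\<Sum>i\<in>J. \<Sum>j\<in>J.
            Y i j * (m r j * cnj (E (m r i)) + cnj (m r i) * E (m r j)))
          + E (l r) * (\<Sum>i\<in>J. \<Sum>j\<in>J. Y i j * (m r j * cnj (m r i)))
          = (if r = s then l s * (c * U + cnj c * V) else 0)"
        using quad[OF r] by simp
    qed
    also have "\<dots> = l s * (c * U + cnj c * V)" using s fin by simp
    finally show ?thesis using s(2) by simp
  qed
  \<comment> \<open>The two real directions separate the conjugate-linear contribution
    \<open>V\<close> from the linear contribution \<open>U\<close>.\<close>
  from UV[of 1] UV[of "\<i>"] have "U + V = 0" "\<i> * (U - V) = 0"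
    by (simp_all add: algebra_simps)
  then show ?thesis by (simp add: V_def[symmetric])
qed

text \<open>Let \<open>S\<close> be the support of \<open>l\<close>. If
  \<open>card S \<le> card J\<close>, the vectors \<open>m t\<close> with \<open>t\<close> in
  \<open>S\<close> have dual vectors, and a rank-one form cannot vanish at a pair of vectors neither
  of which kills \<open>x\<close>. Otherwise a normal matrix \<open>Y\<close> annihilates more
  independent vectors than its size allows.\<close>

lemma rank_one_in_generic_span:
  fixes m :: "'r \<Rightarrow> 'j \<Rightarrow> complex"
  assumes ind: "cnj_independent_entries X J m" and fin: "finite X" "finite J"
    and card: "card X \<le> (card J - 1)\<^sup>2"
    and eq: "\<And>i j. i \<in> J \<Longrightarrow> j \<in> J \<Longrightarrow> x i * cnj (x j) = (\<Sum>r\<in>X. l r * (m r i * cnj (m r j)))"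
    and rs: "r \<in> X" "s \<in> X" "r \<noteq> s" "l r \<noteq> 0"
  shows "l s = 0"
proof (rule ccontr)
  assume ls: "l s \<noteq> 0"
  define S where "S = {r \<in> X. l r \<noteq> 0}"
  have S: "S \<subseteq> X" "finite S" "r \<in> S" "s \<in> S" "\<And>t. t \<in> S \<Longrightarrow> l t \<noteq> 0"
    using fin rs ls by (auto simp: S_def)
  have indS: "cnj_independent_entries S J m"
    by (rule cnj_independent_entries_subset[OF ind S(1) subset_refl])
  have eqS: "x i * cnj (x j) = (\<Sum>r\<in>S. l r * (m r i * cnj (m r j)))" if "i \<in> J" "j \<in> J" for i j
    unfolding eq[OF that] using fin by (intro sum.mono_neutral_right) (auto simp: S_def)
  note form = sesquilinear_form_rank_one[OF eqS, of J]
  show False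
  proof (cases "card S \<le> card J")
    case True
    \<comment> \<open>At a vector dual to \<open>m t\<close> the form leaves the single term
      \<open>l t\<close> times a nonzero square modulus, so \<open>w\<close> does not kill
      \<open>x\<close>.\<close>
    have dual: "\<exists>w. (\<forall>r\<in>S - {t}. (\<Sum>j\<in>J. w j * m r j) = 0) \<and> (\<Sum>j\<in>J. w j * x j) \<noteq> 0"
      if t: "t \<in> S" for t
    proof -
      obtain w where w: "\<forall>r\<in>S - {t}. (\<Sum>j\<in>J. w j * m r j) = 0" "(\<Sum>j\<in>J. w j * m t j) \<noteq> 0"
        using independent_entries_dual[OF cnj_independent_entries_imp[OF indS] S(2) fin(2) True t]
        by blast
      have "(\<Sum>j\<in>J. w j * x j) * cnj (\<Sum>j\<in>J. w j * x j)
          = (\<Sum>r\<in>S. l r * ((\<Sum>j\<in>J. w j * m r j) * cnj (\<Sum>j\<in>J. w j * m r j)))"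
        by (rule form)
      also have "\<dots> = l t * ((\<Sum>j\<in>J. w j * m t j) * cnj (\<Sum>j\<in>J. w j * m t j))"
        using t w(1) S(2) by (simp add: sum.remove[of S t] del: cnj_sum complex_cnj_mult)
      finally have "(\<Sum>j\<in>J. w j * x j) \<noteq> 0" using w(2) S(5)[OF t] by (auto simp del: cnj_sum)
      then show ?thesis using w(1) by blast
    qed
    obtain v w where v: "\<forall>t\<in>S - {r}. (\<Sum>j\<in>J. v j * m t j) = 0" "(\<Sum>j\<in>J. v j * x j) \<noteq> 0"
      and w: "\<forall>t\<in>S - {s}. (\<Sum>j\<in>J. w j * m t j) = 0" "(\<Sum>j\<in>J. w j * x j) \<noteq> 0"
      using dual[OF S(3)] dual[OF S(4)] by blast
    \<comment> \<open>As \<open>r \<noteq> s\<close>, every term contains a factor killed by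
      \<open>v\<close> or by \<open>w\<close>.\<close>
    have "(\<Sum>t\<in>S. l t * ((\<Sum>i\<in>J. v i * m t i) * cnj (\<Sum>j\<in>J. w j * m t j))) = 0"
    proof (rule sum.neutral, rule ballI)
      fix t assume "t \<in> S"
      then have "(\<Sum>i\<in>J. v i * m t i) = 0 \<or> (\<Sum>j\<in>J. w j * m t j) = 0"
        using v(1) w(1) rs(3) by (cases "t = r") auto
      then show "l t * ((\<Sum>i\<in>J. v i * m t i) * cnj (\<Sum>j\<in>J. w j * m t j)) = 0"
        by (auto simp del: cnj_sum)
    qed
    then have "(\<Sum>i\<in>J. v i * x i) * cnj (\<Sum>j\<in>J. w j * x j) = 0" by (simp only: form)
    then show False using v(2) w(2) by (simp del: cnj_sum)
  next
    case False
    have "card X \<noteq> 0" using rs fin by auto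
    then have J: "J \<noteq> {}" using card by auto
    \<comment> \<open>Orthogonality is imposed for all indices but \<open>r\<close>. This saves the
      one equation by which the bound \<open>(card J - 1)\<^sup>2\<close>, attained by
      \<open>card X\<close>, would be too large.\<close>
    have "card (S - {r}) < card S" using S card_Diff1_less by metis
    then have "card (S - {r}) < (card J - 1)\<^sup>2"
      using card card_mono[OF fin(1) S(1)] by linarith
    then obtain Y where Y: "\<exists>i\<in>J. \<exists>j\<in>J. Y i j \<noteq> 0"
      and row: "\<And>i. i \<in> J \<Longrightarrow> (\<Sum>j\<in>J. Y i j * x j) = 0"
      and col: "\<And>j. j \<in> J \<Longrightarrow> (\<Sum>i\<in>J. Y i j * cnj (x i)) = 0"
      and quad: "\<forall>t\<in>S - {r}. (\<Sum>i\<in>J. \<Sum>j\<in>J. Y i j * (m t j * cnj (m t i))) = 0"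
      using exists_normal_matrix[of "S - {r}" J x m] S(2) fin(2) J by blast
    let ?q = "\<lambda>t. \<Sum>i\<in>J. \<Sum>j\<in>J. Y i j * (m t j * cnj (m t i))"
    \<comment> \<open>Pairing the relation with \<open>Y\<close> supplies the missing orthogonality
      for \<open>r\<close>, since \<open>l r \<noteq> 0\<close>.\<close>
    have "0 = (\<Sum>i\<in>J. cnj (x i) * (\<Sum>j\<in>J. Y i j * x j))" using row by simp
    also have "\<dots> = (\<Sum>i\<in>J. \<Sum>j\<in>J. Y i j * (x j * cnj (x i)))"
      by (simp add: sum_distrib_left mult_ac)
    also have "\<dots> = (\<Sum>i\<in>J. \<Sum>j\<in>J. \<Sum>t\<in>S. l t * (Y i j * (m t j * cnj (m t i))))"
      by (intro sum.cong refl) (simp add: eqS sum_distrib_left mult_ac)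
    also have "\<dots> = (\<Sum>t\<in>S. \<Sum>i\<in>J. \<Sum>j\<in>J. l t * (Y i j * (m t j * cnj (m t i))))"
      by (subst sum.swap[of _ S], subst sum.swap[of _ S]) simp
    also have "\<dots> = (\<Sum>t\<in>S. l t * ?q t)"
      by (simp add: sum_distrib_left)
    also have "\<dots> = l r * ?q r"
      using S quad by (simp add: sum.remove[of S r])
    finally have "?q r = 0" using rs(4) by simp
    then have quad': "?q t = 0" if "t \<in> S" for t
      using quad that by (cases "t = r") auto
    have annih: "(\<Sum>j\<in>J. Y k j * m t j) = 0" if "k \<in> J" "t \<in> S" for k t
      by (rule normal_matrix_annihilates[OF indS S(2) fin(2) eqS row col quad' that(2) S(5)[OF that(2)] that(1)])
    \<comment> \<open>Each row of \<open>Y\<close> is a kernel vector of a matrix with independent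
      entries and more rows than columns.\<close>
    have "Y k j = 0" if "k \<in> J" "j \<in> J" for k j
      by (rule independent_entries_kernel[OF cnj_independent_entries_imp[OF indS] S(2) fin(2) _
            annih[OF that(1)] that(2)]) (use False in simp)
    then show False using Y by blast
  qed
qed

section \<open>Uniqueness of the decomposition\<close>

definition part :: "bool \<Rightarrow> complex \<Rightarrow> real" where
  "part b z = (if b then Im z else Re z)"

text \<open>A pair \<open>(b, p)\<close> stands for the real (\<open>b = False\<close>) or imaginary
  part of the coefficients at lag \<open>p\<close>. Lag 1 contributes only a real part, whence the
  count \<open>2 * P - 1\<close>.\<close>

definition slices :: "nat \<Rightarrow> (bool \<times> nat) set" where
  "slices P = insert (False, 1) (UNIV \<times> {2..P})"

lemma finite_slices: "finite (slices P)"
  by (simp add: slices_def)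

lemma card_slices: "1 \<le> P \<Longrightarrow> card (slices P) = 2 * P - 1"
  by (auto simp: slices_def card_insert_if card_cartesian_product)

text \<open>The Hermitian and skew-Hermitian parts of an equation with complex coefficients are equations
  with real coefficients.\<close>

lemma slice_equation:
  fixes m m' :: "nat \<Rightarrow> nat \<Rightarrow> complex"
  assumes "\<And>i j. i < I \<Longrightarrow> j < I \<Longrightarrow>
      (\<Sum>r<R. d r * (m r i * cnj (m r j))) = (\<Sum>r<R. d' r * (m' r i * cnj (m' r j)))"
    and ij: "i < I" "j < I"
  shows "(\<Sum>r<R. complex_of_real (part b (d r)) * (m r i * cnj (m r j)))
       = (\<Sum>r<R. complex_of_real (part b (d' r)) * (m' r i * cnj (m' r j)))"
proof -
  \<comment> \<open>With this \<open>\<alpha>\<close> the real or imaginary part is a combination of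
    \<open>z\<close> and \<open>cnj z\<close>; the equation with conjugated coefficients is the
    conjugate of the one at \<open>(j, i)\<close>.\<close>
  define \<alpha> where "\<alpha> = (if b then - \<i> / 2 else 1 / 2)"
  have part: "complex_of_real (part b z) = \<alpha> * z + cnj \<alpha> * cnj z" for z
    by (auto simp: part_def \<alpha>_def complex_eq_iff)
  have expand: "(\<Sum>r<R. complex_of_real (part b (e r)) * (n r i * cnj (n r j)))
      = \<alpha> * (\<Sum>r<R. e r * (n r i * cnj (n r j))) + cnj \<alpha> * cnj (\<Sum>r<R. e r * (n r j * cnj (n r i)))"
    for e and n :: "nat \<Rightarrow> nat \<Rightarrow> complex"
    by (simp add: part algebra_simps sum.distrib sum_distrib_left)
  show ?thesis unfolding expand using assms(1)[OF ij] assms(1)[OF ij(2,1)] by (simp only:)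
qed

lemma generic_rank_one_nonzero:
  fixes m :: "nat \<Rightarrow> nat \<Rightarrow> complex"
  assumes ind: "cnj_independent_entries {..<R} {..<I} m" and card: "R \<le> (I - 1)\<^sup>2" and r: "r < R"
  shows "\<exists>i<I. m r i \<noteq> 0"
proof -
  \<comment> \<open>Truncated subtraction makes \<open>(0 - 1)\<^sup>2\<close> equal to 0, so
    \<open>r < R\<close> excludes \<open>I = 0\<close>.\<close>
  have "0 < I" using card r by (cases I) auto
  then show ?thesis
    using independent_entries_dual[OF cnj_independent_entries_imp[OF
        cnj_independent_entries_subset[OF ind, of "{r}" "{..<I}"]], of r] r
    by (force intro: ccontr)
qed

text \<open>A linear relation is the case \<open>x = 0\<close> of
  \<open>rank_one_in_generic_span\<close>: at most one coefficient is nonzero, and a single nonzero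
  \<open>m\<^sub>r m\<^sub>r\<^sup>H\<close> admits no relation.\<close>

lemma generic_rank_one_independent:
  fixes m :: "nat \<Rightarrow> nat \<Rightarrow> complex"
  assumes ind: "cnj_independent_entries {..<R} {..<I} m" and card: "R \<le> (I - 1)\<^sup>2"
    and eq: "\<And>i j. i < I \<Longrightarrow> j < I \<Longrightarrow> (\<Sum>r<R. l r * (m r i * cnj (m r j))) = 0"
    and r: "r < R"
  shows "l r = 0"
proof (rule ccontr)
  assume lr: "l r \<noteq> 0"
  have "l s = 0" if "s < R" "s \<noteq> r" for s
    by (rule rank_one_in_generic_span[OF ind, where x = "\<lambda>_. 0" and r = r])
      (use card eq r lr that in auto)
  then have "(\<Sum>s<R. l s * (m s i * cnj (m s i))) = l r * (m r i * cnj (m r i))" for i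
    using r by (simp add: sum.remove[of _ r])
  then show False using eq lr generic_rank_one_nonzero[OF ind card r] by force
qed

text \<open>Each \<open>T s\<close> is a combination of the \<open>T'\<close>. Since the
  \<open>T\<close> are linearly independent, each \<open>T' r\<close> is conversely a combination of
  the \<open>T\<close>, and being of rank one it is a multiple of a single
  \<open>T (\<sigma> r)\<close>. Surjectivity makes \<open>\<sigma>\<close> a permutation;
  independence of the \<open>T\<close> then identifies the coefficients.\<close>

lemma decomposition_unique:
  fixes m m' d d' :: "nat \<Rightarrow> nat \<Rightarrow> complex"
  assumes P: "1 \<le> P"
    and ind: "cnj_independent_entries {..<R} {..<I} m" and card: "R \<le> (I - 1)\<^sup>2"
    and coef: "independent_entries {..<R} (slices P) (\<lambda>r q. part (fst q) (d (snd q) r))"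
    and card': "R \<le> 2 * P - 1"
    and eq: "\<And>p i j. p \<in> {1..P} \<Longrightarrow> i < I \<Longrightarrow> j < I \<Longrightarrow>
      (\<Sum>r<R. d p r * (m r i * cnj (m r j))) = (\<Sum>r<R. d' p r * (m' r i * cnj (m' r j)))"
  shows "\<exists>\<pi> \<zeta>. \<pi> permutes {..<R} \<and> (\<forall>r<R. \<zeta> r \<noteq> 0 \<and> (\<forall>i<I. m' r i = \<zeta> r * m (\<pi> r) i) \<and>
           (\<forall>p\<in>{1..P}. d p (\<pi> r) = d' p r * (cmod (\<zeta> r))\<^sup>2))"
proof -
  define T where "T r i j = m r i * cnj (m r j)" for r i j
  define T' where "T' r i j = m' r i * cnj (m' r j)" for r i j
  have indep: "l r = 0" if "\<And>i j. i < I \<Longrightarrow> j < I \<Longrightarrow> (\<Sum>r<R. l r * T r i j) = 0" "r < R" for l r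
    by (rule generic_rank_one_independent[OF ind card]) (use that in \<open>auto simp: T_def\<close>)
  \<comment> \<open>Because \<open>R \<le> 2 * P - 1\<close>, weights \<open>w\<close> on the slices
    can cancel all terms but \<open>T s\<close> on one side; the same weights express it by the
    \<open>T'\<close> on the other.\<close>
  have "\<forall>s<R. \<exists>b. \<forall>i<I. \<forall>j<I. T s i j = (\<Sum>r<R. b r * T' r i j)"
  proof (intro allI impI)
    fix s assume s: "s < R"
    have "card {..<R} \<le> card (slices P)" using card' card_slices[OF P] by simp
    then obtain w where w: "\<forall>r\<in>{..<R} - {s}. (\<Sum>q\<in>slices P. w q * part (fst q) (d (snd q) r)) = 0"
      "(\<Sum>q\<in>slices P. w q * part (fst q) (d (snd q) s)) \<noteq> 0" (is "?k \<noteq> 0")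
      using independent_entries_dual[OF coef finite_lessThan finite_slices, of s] s by blast
    define b where "b r = complex_of_real ((\<Sum>q\<in>slices P. w q * part (fst q) (d' (snd q) r)) / ?k)" for r
    have "T s i j = (\<Sum>r<R. b r * T' r i j)" if ij: "i < I" "j < I" for i j
    proof -
      have swap: "(\<Sum>q\<in>slices P. complex_of_real (w q) *
            (\<Sum>r<R. complex_of_real (part (fst q) (e (snd q) r)) * X r))
          = (\<Sum>r<R. complex_of_real (\<Sum>q\<in>slices P. w q * part (fst q) (e (snd q) r)) * X r)"
        for e :: "nat \<Rightarrow> nat \<Rightarrow> complex" and X
        unfolding sum_distrib_left of_real_sum sum_distrib_right
        by (subst sum.swap) (simp add: mult_ac)
      have "complex_of_real ?k * T s i j = (\<Sum>r<R. if r = s then complex_of_real ?k * T s i j else 0)"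
        using s by simp
      also have "\<dots> = (\<Sum>r<R. complex_of_real (\<Sum>q\<in>slices P. w q * part (fst q) (d (snd q) r)) * T r i j)"
        using w(1) by (intro sum.cong) (auto simp del: of_real_sum of_real_mult)
      also have "\<dots> = (\<Sum>r<R. complex_of_real (\<Sum>q\<in>slices P. w q * part (fst q) (d' (snd q) r)) * T' r i j)"
      proof -
        have "complex_of_real (w q) * (\<Sum>r<R. complex_of_real (part (fst q) (d (snd q) r)) * T r i j)
            = complex_of_real (w q) * (\<Sum>r<R. complex_of_real (part (fst q) (d' (snd q) r)) * T' r i j)"
          if "q \<in> slices P" for q
        proof -
          have "snd q \<in> {1..P}" using that P by (auto simp: slices_def)
          then show ?thesis
            unfolding T_def T'_def
            by (intro arg_cong[of _ _ "times _"] slice_equation[OF _ ij] eq)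
        qed
        then show ?thesis
          unfolding swap[of d "\<lambda>r. T r i j", symmetric] swap[of d' "\<lambda>r. T' r i j", symmetric]
          by (rule sum.cong[OF refl])
      qed
      also have "\<dots> = complex_of_real ?k * (\<Sum>r<R. b r * T' r i j)"
        unfolding sum_distrib_left
      proof (rule sum.cong[OF refl])
        have cancel: "complex_of_real y = complex_of_real k * complex_of_real (y / k)" if "k \<noteq> 0" for k y
          using that by simp
        show "complex_of_real (\<Sum>q\<in>slices P. w q * part (fst q) (d' (snd q) r)) * T' r i j
            = complex_of_real ?k * (b r * T' r i j)" for r
          unfolding b_def by (subst cancel[OF w(2)]) (rule mult.assoc)
      qed
      finally have scaled: "complex_of_real ?k * T s i j = complex_of_real ?k * (\<Sum>r<R. b r * T' r i j)" .
      have "complex_of_real ?k \<noteq> 0" unfolding of_real_eq_0_iff by (rule w(2))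
      from mult_left_cancel[OF this] scaled show ?thesis by (rule iffD1)
    qed
    then show "\<exists>b. \<forall>i<I. \<forall>j<I. T s i j = (\<Sum>r<R. b r * T' r i j)" by blast
  qed
  then obtain B where B: "\<And>s i j. s < R \<Longrightarrow> i < I \<Longrightarrow> j < I \<Longrightarrow> T s i j = (\<Sum>r<R. B s r * T' r i j)"
    by metis
  have "\<forall>r<R. \<exists>s \<mu>. s < R \<and> \<mu> \<noteq> 0 \<and> (\<forall>i<I. \<forall>j<I. T' r i j = \<mu> * T s i j)"
  proof (intro allI impI)
    fix r assume r: "r < R"
    \<comment> \<open>With one equation fewer than unknowns, \<open>y\<close> combines the rows of
      \<open>B\<close> so that no \<open>T' t\<close> with \<open>t \<noteq> r\<close>
      remains.\<close>
    have "card ({..<R} - {r}) < card {..<R}" using r by (intro psubset_card_mono) auto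
    then obtain y where y: "\<exists>s\<in>{..<R}. y s \<noteq> 0" "\<forall>t\<in>{..<R} - {r}. (\<Sum>s<R. B s t * y s) = 0"
      using homogeneous_solution[of "{..<R} - {r}" "{..<R}" "\<lambda>t s. B s t"] by blast
    define \<kappa> where "\<kappa> = (\<Sum>s<R. B s r * y s)"
    have comb: "(\<Sum>s<R. y s * T s i j) = \<kappa> * T' r i j" if ij: "i < I" "j < I" for i j
    proof -
      have "(\<Sum>s<R. y s * T s i j) = (\<Sum>s<R. \<Sum>t<R. B s t * y s * T' t i j)"
        using B ij by (intro sum.cong refl) (simp add: sum_distrib_left mult_ac)
      also have "\<dots> = (\<Sum>t<R. (\<Sum>s<R. B s t * y s) * T' t i j)"
        unfolding sum_distrib_right by (rule sum.swap)
      also have "\<dots> = (\<Sum>t<R. if t = r then \<kappa> * T' r i j else 0)"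
        using y(2) by (intro sum.cong) (auto simp: \<kappa>_def)
      finally show ?thesis using r by simp
    qed
    \<comment> \<open>Otherwise \<open>y\<close> would be a nontrivial linear relation among the
      \<open>T s\<close>.\<close>
    have \<kappa>: "\<kappa> \<noteq> 0"
    proof
      assume zero: "\<kappa> = 0"
      have "y s = 0" if "s < R" for s
        by (rule indep[OF _ that]) (simp add: comb zero)
      then show False using y(1) by blast
    qed
    obtain s where s: "s < R" "y s \<noteq> 0" using y(1) by auto
    have T': "T' r i j = (\<Sum>t<R. (y t / \<kappa>) * T t i j)" if "i < I" "j < I" for i j
      using comb[OF that] \<kappa> by (simp add: sum_divide_distrib[symmetric] field_simps)
    have "y t / \<kappa> = 0" if "t < R" "t \<noteq> s" for t
      by (rule rank_one_in_generic_span[OF ind, where x = "m' r" and r = s])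
        (use card T' that s \<kappa> in \<open>auto simp: T_def T'_def\<close>)
    then have "T' r i j = y s / \<kappa> * T s i j" if "i < I" "j < I" for i j
      unfolding T'[OF that] using s \<kappa> by (simp add: sum.remove[of _ s])
    then show "\<exists>s \<mu>. s < R \<and> \<mu> \<noteq> 0 \<and> (\<forall>i<I. \<forall>j<I. T' r i j = \<mu> * T s i j)"
      using s \<kappa> by (intro exI[of _ s] exI[of _ "y s / \<kappa>"]) simp
  qed
  then obtain \<sigma> \<mu> where \<sigma>: "\<And>r. r < R \<Longrightarrow> \<sigma> r < R" and \<mu>: "\<And>r. r < R \<Longrightarrow> \<mu> r \<noteq> 0"
    and T': "\<And>r i j. r < R \<Longrightarrow> i < I \<Longrightarrow> j < I \<Longrightarrow> T' r i j = \<mu> r * T (\<sigma> r) i j"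
    by metis
  have surj: "\<sigma> ` {..<R} = {..<R}"
  proof (intro equalityI subsetI)
    fix s assume s: "s \<in> {..<R}"
    show "s \<in> \<sigma> ` {..<R}"
    proof (rule ccontr)
      assume nots: "s \<notin> \<sigma> ` {..<R}"
      \<comment> \<open>If \<open>s\<close> is missed, \<open>T s\<close> is a combination of
        matrices \<open>T (\<sigma> r)\<close> other than itself; collecting terms by
        \<open>\<sigma>\<close> gives a relation whose coefficient at \<open>s\<close> is 1.\<close>
      define l where "l t = (if t = s then 1 else 0)
        - (\<Sum>r\<in>{r \<in> {..<R}. \<sigma> r = t}. B s r * \<mu> r)" for t
      have rel: "(\<Sum>t<R. l t * T t i j) = 0" if ij: "i < I" "j < I" for i j
      proof -
        have "(\<Sum>t<R. (\<Sum>r\<in>{r \<in> {..<R}. \<sigma> r = t}. B s r * \<mu> r) * T t i j)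
            = (\<Sum>t<R. \<Sum>r\<in>{r \<in> {..<R}. \<sigma> r = t}. B s r * \<mu> r * T (\<sigma> r) i j)"
          unfolding sum_distrib_right by (intro sum.cong) auto
        also have "\<dots> = (\<Sum>r<R. B s r * \<mu> r * T (\<sigma> r) i j)"
          by (rule sum.group) (use \<sigma> in auto)
        also have "\<dots> = (\<Sum>t<R. (if t = s then 1 else 0) * T t i j)"
          using B[of s i j] T' ij s by (simp add: mult.assoc if_distrib[of "\<lambda>x. x * _"] cong: if_cong)
        finally show ?thesis by (simp add: l_def left_diff_distrib sum_subtractf)
      qed
      have "l s = 0" by (rule indep[OF rel]) (use s in simp_all)
      moreover have empty: "{r \<in> {..<R}. \<sigma> r = s} = {}" using nots by auto
      have "l s = 1" unfolding l_def empty by simp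
      ultimately show False by simp
    qed
  qed (use \<sigma> in auto)
  define \<pi> where "\<pi> r = (if r < R then \<sigma> r else r)" for r
  have "\<pi> ` {..<R} = {..<R}" using surj by (auto simp: \<pi>_def)
  then have "bij_betw \<pi> {..<R} {..<R}"
    using eq_card_imp_inj_on[of "{..<R}" \<pi>] by (simp add: bij_betw_def)
  then have \<pi>: "\<pi> permutes {..<R}" by (rule bij_imp_permutes) (simp add: \<pi>_def)
  have "\<forall>r<R. \<exists>z. z \<noteq> 0 \<and> (\<forall>i<I. m' r i = z * m (\<pi> r) i)"
  proof (intro allI impI)
    fix r assume r: "r < R"
    have eq': "m' r i * cnj (m' r j) = \<mu> r * (m (\<pi> r) i * cnj (m (\<pi> r) j))" if "i < I" "j < I" for i j
      using T'[OF r that] r by (simp add: T_def T'_def \<pi>_def)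
    obtain k where k: "k < I" "m (\<pi> r) k \<noteq> 0"
      using generic_rank_one_nonzero[OF ind card, of "\<pi> r"] \<sigma> r by (auto simp: \<pi>_def)
    then have k': "m' r k \<noteq> 0" using eq'[OF k(1) k(1)] \<mu>[OF r] by auto
    show "\<exists>z. z \<noteq> 0 \<and> (\<forall>i<I. m' r i = z * m (\<pi> r) i)"
      \<comment> \<open>The factor is read off from column \<open>k\<close> of the two proportional
        rank-one matrices.\<close>
      using eq'[OF _ k(1)] k k' \<mu>[OF r]
      by (intro exI[of _ "\<mu> r * cnj (m (\<pi> r) k) / cnj (m' r k)"]) (auto simp: field_simps)
  qed
  then obtain \<zeta> where \<zeta>: "\<And>r. r < R \<Longrightarrow> \<zeta> r \<noteq> 0"
    "\<And>r i. r < R \<Longrightarrow> i < I \<Longrightarrow> m' r i = \<zeta> r * m (\<pi> r) i"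
    by metis
  define \<rho> where "\<rho> = inv_into UNIV \<pi>"
  have \<rho>: "\<rho> (\<pi> r) = r" for r unfolding \<rho>_def by (rule permutes_inverses(2)[OF \<pi>])
  have "d p (\<pi> r) = d' p r * (cmod (\<zeta> r))\<^sup>2" if p: "p \<in> {1..P}" and r: "r < R" for p r
  proof -
    \<comment> \<open>As \<open>T' r\<close> is \<open>(cmod (\<zeta> r))\<^sup>2\<close> times
      \<open>T (\<pi> r)\<close>, both sides of the system are combinations of the \<open>T\<close>;
      \<open>e\<close> is the difference of their coefficients.\<close>
    define e where "e r = d p (\<pi> r) - d' p r * (cmod (\<zeta> r))\<^sup>2" for r
    have rel: "(\<Sum>t<R. e (\<rho> t) * T t i j) = 0" if ij: "i < I" "j < I" for i j
    proof -
      have "(\<Sum>t<R. e (\<rho> t) * T t i j) = (\<Sum>r<R. e r * T (\<pi> r) i j)"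
        using sum.permute[OF \<pi>, of "\<lambda>t. e (\<rho> t) * T t i j"]
        by (simp add: o_def \<rho>)
      also have "\<dots> = (\<Sum>r<R. d p (\<pi> r) * T (\<pi> r) i j) - (\<Sum>r<R. d' p r * T' r i j)"
        unfolding sum_subtractf[symmetric]
      proof (rule sum.cong[OF refl])
        fix r assume "r \<in> {..<R}"
        then have "T' r i j = (\<zeta> r * cnj (\<zeta> r)) * T (\<pi> r) i j"
          using \<zeta>(2) ij by (simp add: T_def T'_def mult_ac)
        also have "\<zeta> r * cnj (\<zeta> r) = (cmod (\<zeta> r))\<^sup>2" by (rule complex_norm_square[symmetric])
        finally show "e r * T (\<pi> r) i j = d p (\<pi> r) * T (\<pi> r) i j - d' p r * T' r i j"
          by (simp add: e_def algebra_simps)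
      qed
      also have "(\<Sum>r<R. d p (\<pi> r) * T (\<pi> r) i j) = (\<Sum>t<R. d p t * T t i j)"
        using sum.permute[OF \<pi>, of "\<lambda>t. d p t * T t i j"] by (simp add: o_def)
      finally show ?thesis using eq[OF p ij] by (simp add: T_def T'_def)
    qed
    have "e (\<rho> (\<pi> r)) = 0"
      by (rule indep[of "\<lambda>t. e (\<rho> t)", OF rel]) (use r permutes_in_image[OF \<pi>, of r] in simp_all)
    then show ?thesis by (simp add: e_def \<rho>)
  qed
  then show ?thesis using \<pi> \<zeta> by blast
qed

section \<open>The system in matrix form\<close>

lemma mult_permutation_matrix:
  fixes X :: "complex mat"
  assumes "X \<in> carrier_mat k R" "\<pi> permutes {..<R}"
  shows "X * mat R R (\<lambda>(i, j). if i = \<pi> j then 1 else 0) = mat k R (\<lambda>(i, j). X $$ (i, \<pi> j))"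
    (is "_ * ?Q = _")
proof (rule eq_matI)
  fix i j assume "i < dim_row (mat k R (\<lambda>(i, j). X $$ (i, \<pi> j)))" "j < dim_col (mat k R (\<lambda>(i, j). X $$ (i, \<pi> j)))"
  then have ij: "i < k" "j < R" by auto
  have "(X * ?Q) $$ (i, j) = (\<Sum>l\<in>{0..<R}. X $$ (i, l) * (if l = \<pi> j then 1 else 0))"
    using assms ij by (auto simp: scalar_prod_def)
  also have "\<dots> = (\<Sum>l\<in>{0..<R}. if l = \<pi> j then X $$ (i, l) else 0)"
    by (rule sum.cong) auto
  also have "\<dots> = X $$ (i, \<pi> j)" using permutes_in_image[OF assms(2), of j] ij by simp
  finally show "(X * ?Q) $$ (i, j) = mat k R (\<lambda>(i, j). X $$ (i, \<pi> j)) $$ (i, j)"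
    using ij by simp
qed (use assms in auto)

lemma transpose_permutation_matrix_mult:
  fixes X :: "complex mat"
  assumes "X \<in> carrier_mat R k" "\<pi> permutes {..<R}"
  shows "transpose_mat (mat R R (\<lambda>(i, j). if i = \<pi> j then 1 else 0)) * X
       = mat R k (\<lambda>(i, j). X $$ (\<pi> i, j))"
    (is "transpose_mat ?Q * _ = _")
proof (rule eq_matI)
  fix i j assume "i < dim_row (mat R k (\<lambda>(i, j). X $$ (\<pi> i, j)))" "j < dim_col (mat R k (\<lambda>(i, j). X $$ (\<pi> i, j)))"
  then have ij: "i < R" "j < k" by auto
  have "(transpose_mat ?Q * X) $$ (i, j) = (\<Sum>l\<in>{0..<R}. (if l = \<pi> i then 1 else 0) * X $$ (l, j))"
    using assms ij by (auto simp: scalar_prod_def)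
  also have "\<dots> = (\<Sum>l\<in>{0..<R}. if l = \<pi> i then X $$ (l, j) else 0)"
    by (rule sum.cong) auto
  also have "\<dots> = X $$ (\<pi> i, j)" using permutes_in_image[OF assms(2), of i] ij by simp
  finally show "(transpose_mat ?Q * X) $$ (i, j) = mat R k (\<lambda>(i, j). X $$ (\<pi> i, j)) $$ (i, j)"
    using ij by simp
qed (use assms in auto)

lemma diagonal_unitary_mat_diag:
  assumes "\<And>r. r < R \<Longrightarrow> cmod (f r) = 1"
  shows "diagonal_unitary R (mat_diag R f)"
proof -
  have unit: "f r * cnj (f r) = 1" if "r < R" for r
    using complex_norm_square[of "f r"] assms[OF that] by simp
  have "mat_adjoint (mat_diag R f) = mat_diag R (\<lambda>r. cnj (f r))"
    by (rule eq_matI) (auto simp: mat_diag_def)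
  then have "mat_diag R f * mat_adjoint (mat_diag R f) = mat_diag R (\<lambda>r. f r * cnj (f r))"
    by (simp add: mat_diag_diag)
  also have "\<dots> = 1\<^sub>m R" by (rule eq_matI) (auto simp: mat_diag_def unit)
  finally show ?thesis by (auto simp: diagonal_unitary_def diagonal_mat_def mat_diag_def)
qed

text \<open>The polar form of each factor \<open>\<zeta> r\<close> provides the rest of the
  indeterminacy: the modulus is a positive scaling, the phase an entry of a unitary diagonal
  matrix.\<close>

lemma trivially_relatedI:
  assumes par: "parameters I R P M D" and par': "parameters I R P M' D'"
    and \<pi>: "\<pi> permutes {..<R}"
    and \<zeta>: "\<And>r. r < R \<Longrightarrow> \<zeta> r \<noteq> 0"
    and M': "\<And>r i. r < R \<Longrightarrow> i < I \<Longrightarrow> M' $$ (i, r) = \<zeta> r * M $$ (i, \<pi> r)"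
    and D': "\<And>r p. r < R \<Longrightarrow> p \<in> {1..P} \<Longrightarrow> D p $$ (\<pi> r, \<pi> r) = D' p $$ (r, r) * (cmod (\<zeta> r))\<^sup>2"
  shows "trivially_related R P M D M' D'"
proof -
  have M: "M \<in> carrier_mat I R" and Mc': "M' \<in> carrier_mat I R"
    and D: "\<And>p. p \<in> {1..P} \<Longrightarrow> D p \<in> carrier_mat R R" "\<And>p. p \<in> {1..P} \<Longrightarrow> diagonal_mat (D p)"
    and Dc': "\<And>p. p \<in> {1..P} \<Longrightarrow> D' p \<in> carrier_mat R R" "\<And>p. p \<in> {1..P} \<Longrightarrow> diagonal_mat (D' p)"
    using par par' by (auto simp: parameters_def)
  define Q :: "complex mat" where "Q = mat R R (\<lambda>(i, j). if i = \<pi> j then 1 else 0)"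
  define \<rho> where "\<rho> = inv_into UNIV \<pi>"
  \<comment> \<open>The inverse permutation \<open>\<rho>\<close> enters because scaling and phases
    act on the columns before \<open>Q\<close> permutes them.\<close>
  define s where "s r = cmod (\<zeta> (\<rho> r))" for r
  define L where "L = mat_diag R (\<lambda>r. \<zeta> (\<rho> r) / s r)"
  have inv: "\<rho> (\<pi> r) = r" for r unfolding \<rho>_def by (rule permutes_inverses(2)[OF \<pi>])
  have \<pi>R: "\<pi> r < R" if "r < R" for r using permutes_in_image[OF \<pi>, of r] that by simp
  have s: "0 < s r" if "r < R" for r
    using permutes_in_image[OF permutes_inv[OF \<pi>], of r] that \<zeta> by (simp add: s_def \<rho>_def)
  have "diagonal_unitary R L"
    unfolding L_def using s by (intro diagonal_unitary_mat_diag) (force simp: norm_divide s_def)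
  moreover have "permutation_matrix R Q" using \<pi> by (auto simp: permutation_matrix_def Q_def)
  moreover have "M' = M * L * real_diag R s * Q"
  proof -
    have M_L: "M * L = mat I R (\<lambda>(i, j). M $$ (i, j) * (\<zeta> (\<rho> j) / s j))"
      unfolding L_def by (rule mat_diag_mult_right[OF M])
    have "M * L * real_diag R s = mat I R (\<lambda>(i, j). (M * L) $$ (i, j) * s j)"
      by (rule mat_diag_mult_right) (simp add: M_L)
    also have "\<dots> = mat I R (\<lambda>(i, j). M $$ (i, j) * \<zeta> (\<rho> j))"
      using s by (intro cong_mat) (force simp: M_L)+
    finally have "M * L * real_diag R s * Q
        = mat I R (\<lambda>(i, j). mat I R (\<lambda>(i, j). M $$ (i, j) * \<zeta> (\<rho> j)) $$ (i, \<pi> j))"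
      unfolding Q_def by (simp add: mult_permutation_matrix[OF _ \<pi>])
    also have "\<dots> = M'" using Mc' \<pi>R by (intro eq_matI) (auto simp: inv M' mult.commute)
    finally show ?thesis ..
  qed
  moreover have "D' p = transpose_mat Q * (real_diag R (\<lambda>r. 1 / s r) * D p * real_diag R (\<lambda>r. 1 / s r)) * Q"
    if p: "p \<in> {1..P}" for p
  proof -
    let ?X = "mat R R (\<lambda>(i, j). complex_of_real (1 / s i) * D p $$ (i, j) * complex_of_real (1 / s j))"
    let ?Y = "mat R R (\<lambda>(i, j). ?X $$ (\<pi> i, j))"
    have "transpose_mat Q * (real_diag R (\<lambda>r. 1 / s r) * D p * real_diag R (\<lambda>r. 1 / s r)) * Q = ?Y * Q"
      unfolding real_diag_conj[OF D(1)[OF p]] Q_def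
      by (rule arg_cong[of _ _ "\<lambda>Y. Y * _"], rule transpose_permutation_matrix_mult[OF _ \<pi>]) (rule mat_carrier)
    also have "\<dots> = mat R R (\<lambda>(i, j). ?Y $$ (i, \<pi> j))"
      unfolding Q_def by (rule mult_permutation_matrix[OF mat_carrier \<pi>])
    also have "\<dots> = D' p"
    proof (rule eq_matI)
      fix i j assume "i < dim_row (D' p)" "j < dim_col (D' p)"
      then have ij: "i < R" "j < R" using Dc'(1)[OF p] by auto
      have "?X $$ (\<pi> i, \<pi> j) = D' p $$ (i, j)"
      proof (cases "i = j")
        case True
        have "s (\<pi> i) = cmod (\<zeta> i)" by (simp add: s_def inv)
        then show ?thesis using ij \<pi>R D'[OF ij(1) p] \<zeta>[OF ij(1)] True
          by (simp add: power2_eq_square)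
      next
        case False
        then have "\<pi> i \<noteq> \<pi> j" using inv by metis
        then show ?thesis using False ij \<pi>R D[OF p] Dc'[OF p] by (auto simp: diagonal_mat_def)
      qed
      then show "mat R R (\<lambda>(i, j). ?Y $$ (i, \<pi> j)) $$ (i, j) = D' p $$ (i, j)"
        using ij \<pi>R by simp
    qed (use Dc'(1)[OF p] in auto)
    finally show ?thesis ..
  qed
  ultimately show ?thesis unfolding trivially_related_def using s by blast
qed

lemma unique_solution_if_independent:
  assumes par: "parameters I R P M D" and P: "1 \<le> P"
    and ind: "cnj_independent_entries {..<R} {..<I} (\<lambda>r i. M $$ (i, r))"
    and coef: "independent_entries {..<R} (slices P) (\<lambda>r q. part (fst q) (D (snd q) $$ (r, r)))"
    and card: "R \<le> (I - 1)\<^sup>2" "R \<le> 2 * P - 1"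
  shows "unique_solution I R P (\<lambda>p. M * D p * mat_adjoint M)"
  unfolding unique_solution_def
proof (intro exI conjI allI impI)
  show "is_solution I R P (\<lambda>p. M * D p * mat_adjoint M) M D" using par by (simp add: is_solution_def)
next
  fix M' D' assume "is_solution I R P (\<lambda>p. M * D p * mat_adjoint M) M' D'"
  then have par': "parameters I R P M' D'"
    and sol: "\<And>p. p \<in> {1..P} \<Longrightarrow> M * D p * mat_adjoint M = M' * D' p * mat_adjoint M'"
    by (auto simp: is_solution_def)
  have eq: "(\<Sum>r<R. D p $$ (r, r) * (M $$ (i, r) * cnj (M $$ (j, r))))
      = (\<Sum>r<R. D' p $$ (r, r) * (M' $$ (i, r) * cnj (M' $$ (j, r))))"
    if "p \<in> {1..P}" "i < I" "j < I" for p i j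
  proof -
    have "(\<Sum>r<R. D p $$ (r, r) * (M $$ (i, r) * cnj (M $$ (j, r)))) = (M * D p * mat_adjoint M) $$ (i, j)"
      using par that by (intro system_entry[symmetric, of _ I]) (simp_all add: parameters_def)
    also have "\<dots> = (M' * D' p * mat_adjoint M') $$ (i, j)" by (simp only: sol[OF that(1)])
    also have "\<dots> = (\<Sum>r<R. D' p $$ (r, r) * (M' $$ (i, r) * cnj (M' $$ (j, r))))"
      using par' that by (intro system_entry[of _ I]) (simp_all add: parameters_def)
    finally show ?thesis .
  qed
  obtain \<pi> \<zeta> where "\<pi> permutes {..<R}"
    "\<forall>r<R. \<zeta> r \<noteq> 0 \<and> (\<forall>i<I. M' $$ (i, r) = \<zeta> r * M $$ (i, \<pi> r)) \<and>
       (\<forall>p\<in>{1..P}. D p $$ (\<pi> r, \<pi> r) = D' p $$ (r, r) * (cmod (\<zeta> r))\<^sup>2)"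
    using decomposition_unique[OF P ind card(1) coef card(2) eq] by blast
  then show "trivially_related R P M D M' D'"
    by (intro trivially_relatedI[OF par par', of \<pi> \<zeta>]) auto
qed

section \<open>Genericity in terms of the real coordinates\<close>

lemma concat_map_nth:
  assumes "\<And>x. x \<in> set xs \<Longrightarrow> length (f x) = n" "r < length xs" "i < n"
  shows "concat (map f xs) ! (r * n + i) = f (xs ! r) ! i"
  using assms
proof (induction xs arbitrary: r)
  case (Cons x xs)
  then show ?case by (cases r) (auto simp: nth_append)
qed simp

lemma column_list_nth:
  assumes "r < dim_col A" "i < dim_row A"
  shows "column_list A ! (r * dim_row A + i) = A $$ (i, r)"
proof -
  have "concat (map list_of_vec (cols A)) ! (r * dim_row A + i) = list_of_vec (cols A ! r) ! i"
    by (rule concat_map_nth) (use assms in \<open>auto simp: cols_def\<close>)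
  then show ?thesis using assms by (simp add: column_list_def list_of_vec_index)
qed

lemma block_index_less: "r * n + i < R * n" if "r < R" "i < (n::nat)"
proof -
  have "r * n + i < Suc r * n" using that by simp
  also have "\<dots> \<le> R * n" using that by (intro mult_le_mono1) simp
  finally show ?thesis .
qed

lemma block_index_inj:
  assumes "r * n + i = s * n + j" "i < n" "j < (n::nat)"
  shows "r = s \<and> i = j"
proof -
  have "(r * n + i) div n = r" "(r * n + i) mod n = i" "(s * n + j) div n = s" "(s * n + j) mod n = j"
    using assms(2,3) by simp_all
  then show ?thesis using assms(1) by simp
qed

context
  fixes I R P :: nat and M :: "complex mat" and D :: "nat \<Rightarrow> complex mat"
  assumes M: "M \<in> carrier_mat I R" and P: "1 \<le> P"
begin

lemma coordinates_nth:
  "k < (2 * I + 2 * P - 1) * R \<Longrightarrow> coordinates R P M D k = coordinate_list R P M D ! k"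
  using length_coordinate_list[OF M P, of D] by (simp add: coordinates_def Let_def)

lemma coordinate_count: "(2 * I + 2 * P - 1) * R = R + 2 * (R * (P - 1)) + R * (2 * I)"
  using P by (cases P) (simp_all add: algebra_simps)

text \<open>Position in \<open>coordinate_list\<close>: the \<open>R\<close> entries of
  \<open>D 1\<close>, then the real and the imaginary parts of \<open>D_bar\<close> column by
  column. Row 0 of \<open>D_bar\<close> belongs to lag 2, hence the shift.\<close>

definition coefficient_index :: "nat \<Rightarrow> bool \<times> nat \<Rightarrow> nat" where
  "coefficient_index r q = (if snd q = 1 then r
     else R + (if fst q then R * (P - 1) else 0) + (r * (P - 1) + (snd q - 2)))"

text \<open>Each column of \<open>M\<close> occupies a block of \<open>2 * I\<close> coordinates,
  the real parts before the imaginary parts.\<close>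

definition column_index :: "nat \<Rightarrow> nat \<Rightarrow> bool \<Rightarrow> nat" where
  "column_index r i b = R + 2 * (R * (P - 1)) + (r * (2 * I) + ((if b then I else 0) + i))"

lemma coefficient_index_less:
  assumes "r < R" "q \<in> slices P"
  shows "coefficient_index r q < (2 * I + 2 * P - 1) * R"
proof (cases "snd q = 1")
  case False
  then have "snd q - 2 < P - 1" using assms by (auto simp: slices_def)
  from block_index_less[OF assms(1) this] show ?thesis
    unfolding coordinate_count using False by (simp add: coefficient_index_def)
next
  case True
  then show ?thesis unfolding coordinate_count using assms by (simp add: coefficient_index_def)
qed

lemma column_index_less:
  assumes "r < R" "i < I"
  shows "column_index r i b < (2 * I + 2 * P - 1) * R"
proof -
  have "(if b then I else 0) + i < 2 * I" using assms(2) by simp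
  from block_index_less[OF assms(1) this] show ?thesis
    unfolding coordinate_count column_index_def by linarith
qed

lemma coefficient_index_inj:
  assumes "r < R" "q \<in> slices P" "s < R" "q' \<in> slices P" "coefficient_index r q = coefficient_index s q'"
  shows "r = s \<and> q = q'"
proof (cases "snd q = 1 \<or> snd q' = 1")
  case True
  then show ?thesis using assms
    by (auto simp: coefficient_index_def slices_def split: if_splits)
next
  case False
  then have le: "snd q - 2 < P - 1" "snd q' - 2 < P - 1" "2 \<le> snd q" "2 \<le> snd q'"
    using assms by (auto simp: slices_def)
  define x where "x = r * (P - 1) + (snd q - 2)"
  define y where "y = s * (P - 1) + (snd q' - 2)"
  have "x < R * (P - 1)" "y < R * (P - 1)"
    unfolding x_def y_def using block_index_less assms(1,3) le(1,2) by auto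
  moreover have "R + (if fst q then R * (P - 1) else 0) + x = R + (if fst q' then R * (P - 1) else 0) + y"
    using assms(5) False by (simp add: coefficient_index_def x_def y_def)
  ultimately have "fst q = fst q'" "x = y" by (auto split: if_splits)
  moreover from this(2) have "r = s \<and> snd q - 2 = snd q' - 2"
    unfolding x_def y_def by (rule block_index_inj[OF _ le(1,2)])
  ultimately show ?thesis using le(3,4) by (auto simp: prod_eq_iff)
qed

lemma column_index_inj:
  assumes "i < I" "j < I" "column_index r i b = column_index s j c"
  shows "r = s \<and> i = j \<and> b = c"
proof -
  define x where "x = (if b then I else 0) + i"
  define y where "y = (if c then I else 0) + j"
  have "r * (2 * I) + x = s * (2 * I) + y" using assms(3) by (simp add: column_index_def x_def y_def)
  moreover have "x < 2 * I" "y < 2 * I" using assms(1,2) by (auto simp: x_def y_def)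
  ultimately have "r = s \<and> x = y" by (rule block_index_inj)
  then show ?thesis using assms(1,2) by (auto simp: x_def y_def split: if_splits)
qed

lemma coordinates_coefficient:
  assumes r: "r < R" and q: "q \<in> slices P"
  shows "coordinates R P M D (coefficient_index r q) = part (fst q) (D (snd q) $$ (r, r))"
proof -
  have len: "length (column_list (map_mat f (D_bar R P D))) = R * (P - 1)" for f :: "complex \<Rightarrow> real"
    by (simp add: length_column_list D_bar_def)
  show ?thesis
  proof (cases "snd q = 1")
    case True
    then have "fst q = False" using q by (auto simp: slices_def)
    then show ?thesis
      unfolding coordinates_nth[OF coefficient_index_less[OF r q]] using True r
      by (simp add: coefficient_index_def coordinate_list_def nth_append part_def)
  next
    case False
    then have i: "snd q - 2 < P - 1" "snd q = snd q - 2 + 2" using q by (auto simp: slices_def)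
    have "column_list (map_mat f (D_bar R P D)) ! (r * (P - 1) + (snd q - 2)) = f (D (snd q) $$ (r, r))"
      for f :: "complex \<Rightarrow> real"
      using column_list_nth[of r "map_mat f (D_bar R P D)" "snd q - 2"] r i
      by (simp add: D_bar_def)
    then show ?thesis
      unfolding coordinates_nth[OF coefficient_index_less[OF r q]]
      using False block_index_less[OF r i(1)]
      by (simp add: coefficient_index_def coordinate_list_def nth_append part_def len)
  qed
qed

lemma coordinates_column:
  assumes r: "r < R" and i: "i < I"
  shows "coordinates R P M D (column_index r i b) = part b (M $$ (i, r))"
proof -
  let ?f = "\<lambda>m. map Re (list_of_vec m) @ map Im (list_of_vec m)"
  have len: "length (column_list (map_mat f (D_bar R P D))) = R * (P - 1)" for f :: "complex \<Rightarrow> real"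
    by (simp add: length_column_list D_bar_def)
  have "coordinates R P M D (column_index r i b)
      = concat (map ?f (cols M)) ! (r * (2 * I) + ((if b then I else 0) + i))"
    unfolding coordinates_nth[OF column_index_less[OF r i]]
    by (simp add: column_index_def coordinate_list_def nth_append len)
  also have "\<dots> = ?f (cols M ! r) ! ((if b then I else 0) + i)"
    by (rule concat_map_nth) (use M r i in \<open>auto simp: cols_def\<close>)
  also have "\<dots> = part b (M $$ (i, r))"
    using M r i by (auto simp: part_def nth_append list_of_vec_index)
  finally show ?thesis .
qed

lemma unique_solution_if_generic:
  assumes gen: "generic_point ((2 * I + 2 * P - 1) * R) (coordinates R P M D)"
    and par: "parameters I R P M D" and card: "R \<le> (I - 1)\<^sup>2" "R \<le> 2 * P - 1"
  shows "unique_solution I R P (\<lambda>p. M * D p * mat_adjoint M)"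
proof (rule unique_solution_if_independent[OF par P _ _ card])
  show "cnj_independent_entries {..<R} {..<I} (\<lambda>r i. M $$ (i, r))"
  proof (rule generic_cnj_independent_entries[OF gen, where f = column_index])
    fix r i assume "r \<in> {..<R}" "i \<in> {..<I}"
    then have ri: "r < R" "i < I" by auto
    then show "M $$ (i, r) = Complex (coordinates R P M D (column_index r i False))
          (coordinates R P M D (column_index r i True)) \<and>
        column_index r i False < (2 * I + 2 * P - 1) * R \<and>
        column_index r i True < (2 * I + 2 * P - 1) * R"
      using column_index_less[OF ri] by (simp add: coordinates_column part_def)
  next
    fix r i a s j b assume "r \<in> {..<R}" "i \<in> {..<I}" "s \<in> {..<R}" "j \<in> {..<I}"
      "column_index r i a = column_index s j b"
    then show "r = s \<and> i = j \<and> a = b" using column_index_inj[of i j r a s b] by simp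
  qed
  show "independent_entries {..<R} (slices P) (\<lambda>r q. part (fst q) (D (snd q) $$ (r, r)))"
  proof (rule generic_independent_entries[OF gen, where f = coefficient_index])
    fix r s q q' assume "r \<in> {..<R}" "q \<in> slices P" "s \<in> {..<R}" "q' \<in> slices P"
      "coefficient_index r q = coefficient_index s q'"
    then show "r = s \<and> q = q'" using coefficient_index_inj by simp
  next
    fix r q assume "r \<in> {..<R}" "q \<in> slices P"
    then have rq: "r < R" "q \<in> slices P" by auto
    show "part (fst q) (D (snd q) $$ (r, r)) = coordinates R P M D (coefficient_index r q) \<and>
        coefficient_index r q < (2 * I + 2 * P - 1) * R"
      using coefficient_index_less[OF rq] coordinates_coefficient[OF rq] by simp
  qed
qed

end

theorem theorem3:
  fixes I R P n :: nat and \<mu> :: "(nat \<Rightarrow> real) measure"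
  assumes "1 \<le> I" and "1 \<le> P"
    and "R \<le> min (2 * P - 1) ((I - 1)\<^sup>2)"
    and "n = (2 * I + 2 * P - 1) * R"
    and "sets \<mu> = sets (lebesgue_on_nat n)"
    and "absolutely_continuous (lebesgue_on_nat n) \<mu>"
  shows "{coordinates R P M D | M D.
            parameters I R P M D \<and>
            \<not> unique_solution I R P (\<lambda>p. M * D p * mat_adjoint M)} \<in> null_sets \<mu>"
    (is "?bad \<in> _")
proof -
  let ?N = "{\<xi> \<in> space (lebesgue_on_nat n). \<not> generic_point n \<xi>}"
  have "?bad \<subseteq> ?N"
  proof
    fix \<xi> assume "\<xi> \<in> ?bad"
    then obtain M D where \<xi>: "\<xi> = coordinates R P M D" and par: "parameters I R P M D"
      and bad: "\<not> unique_solution I R P (\<lambda>p. M * D p * mat_adjoint M)"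
      by blast
    have M: "M \<in> carrier_mat I R" using par by (simp add: parameters_def)
    show "\<xi> \<in> ?N"
      using coordinates_in_space[OF M assms(2)] unique_solution_if_generic[OF M assms(2) _ par] bad assms(3)
      by (auto simp: \<xi> assms(4))
  qed
  moreover have "?N \<in> null_sets (completion (\<Pi>\<^sub>M k\<in>{..<n}. lborel))"
    using null_not_generic[of n] by (simp add: lebesgue_on_nat_def)
  \<comment> \<open>Completeness makes \<open>?bad\<close> measurable as a subset of a null
    set.\<close>
  ultimately have "?bad \<in> null_sets (lebesgue_on_nat n)"
    unfolding lebesgue_on_nat_def by (rule null_sets_completion_subset)
  then show ?thesis using assms(6) by (auto simp: absolutely_continuous_def)
qed

end
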